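(* The category $\mathbf{uCBCov}_i$ of inductively generated unital convergent covers (with unital convergent cover maps) is equivalent to the category of commutative co-monoids in the symmetric monoidal category $\mathbf{BCov}_i$ of inductively generated basic covers.
   Context: A basic cover $\mathcal S=(S,\lhd)$ on a set $S$ is a relation $\lhd$ between elements and subsets of $S$ such that $a\in U$ implies $a\lhd U$, and $a\lhd U$, $U\lhd V$ imply $a\lhd V$, where $U\lhd V$ means $b\lhd V$ for all $b\in U$. Put $\mathcal A U=\{a\in S\mid a\lhd U\}$; $U=_{\mathcal A}V$ means $\mathcal A U=\mathcal A V$. $Sat(\mathcal A)=\{U\subseteq S\mid U=\mathcal A U\}$ has joins $\bigvee^{\mathcal A}_i\mathcal A U_i=\mathcal A(\bigcup_iU_i)$. Elements are identified with singletons. For a relation $r$ between $S$ and $T$ and $V\subseteq T$, $r^-V=\{a\in S\mid \exists b\in V,\ a\,r\,b\}$. A basic cover map $r:(S,\lhd_S)\to(T,\lhd_T)$ is a relation $r$ between $S$ and $T$ such that $b\lhd_TV$ implies $r^-b\lhd_Sr^-V$; two basic cover maps are equal if $r_1^-b=_{\mathcal A_S}r_2^-b$ for all $b\in T$. Composition is relational composition (so $(s\cdot r)^-=r^-s^-$). This gives the category $\mathbf{BCov}$. An axiom-set $(I,C)$ on $S$: sets $I(a)$ ($a\in S$) and subsets $C(a,i)\subseteq S$ ($i\in I(a)$). It generates the least basic cover $\lhd_{I,C}$ with $a\lhd C(a,i)$ for all $a,i$ (inductively defined by: $a\in U$ implies $a\lhd U$; $i\in I(a)$ and $C(a,i)\lhd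 U$ imply $a\lhd U$). $\mathbf{BCov}_i$ is the full subcategory of $\mathbf{BCov}$ on the inductively generated basic covers, i.e. those of the form $\lhd_{I,C}$. Monoidal structure on $\mathbf{BCov}_i$: if $\mathcal S,\mathcal T$ are generated by $(I,C)$ and $(J,D)$, then $\mathcal S\otimes\mathcal T$ is the basic cover on $S\times T$ generated by the axioms $(a,b)\lhd C(a,i)\times\{b\}$ ($i\in I(a)$) and $(a,b)\lhd\{a\}\times D(b,j)$ ($j\in J(b)$). For morphisms, $r_1\otimes r_2$ is the unique morphism with $(r_1\otimes r_2)^-(b_1,b_2)=_{\mathcal A}(r_1^-b_1)\times(r_2^-b_2)$. The unit $E$ is the basic cover on $\{*\}$ generated by no axioms. The isomorphisms $\alpha:\mathcal S_1\otimes(\mathcal S_2\otimes\mathcal S_3)\to(\mathcal S_1\otimes\mathcal S_2)\otimes\mathcal S_3$, $\gamma:\mathcal S_1\otimes\mathcal S_2\to\mathcal S_2\otimes\mathcal S_1$, $\lambda:E\otimes\mathcal S\to\mathcal S$, $\rho:\mathcal S\otimes E\to\mathcal S$ are determined by $\alpha^-((a_1,a_2),a_3)=_{\mathcal A}(a_1,(a_2,a_3))$, $\gamma^-(a_2,a_1)=_{\mathcal A}(a_1,a_2)$, $\lambda^-a=_{\mathcal A}( *,a)$, $\rho^-a=_{\mathcal A}(a,* )$. A commutative co-monoid in $\mathbf{BCov}_i$ is an object $\mathcal S$ with morphisms $\mu:\mathcal S\to\mathcal S\otimes\mathcal S$ and $\eta:\mathcal S\to E$ such that $\alpha\cdot(id\otimes\mu)\cdot\mu=(\mu\otimes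 id)\cdot\mu$, $\gamma\cdot\mu=\mu$, $(\eta\otimes id)\cdot\mu=\lambda^{-1}$ and $(id\otimes\eta)\cdot\mu=\rho^{-1}$. A morphism $(\mathcal S,\mu,\eta)\to(\mathcal S',\mu',\eta')$ is a basic cover map $r:\mathcal S\to\mathcal S'$ with $\mu'\cdot r=(r\otimes r)\cdot\mu$ and $\eta'\cdot r=\eta$. A convergent cover is $(S,\lhd,\circ)$ where $\lhd$ is a basic cover on $S$ and $\circ$ is a binary operation on $\mathcal P(S)$ such that: $U_1\lhd V_1$ and $U_2\lhd V_2$ imply $U_1\circ U_2\lhd V_1\circ V_2$; $(U\circ V)\circ W\lhd U\circ(V\circ W)$; $U\circ V\lhd V\circ U$; and the operation $\mathcal A U\circ^{\mathcal A}\mathcal A V=\mathcal A(U\circ V)$ on $Sat(\mathcal A)$ distributes over arbitrary joins. Write $a\circ b=\{a\}\circ\{b\}$, etc. It is unital if there is a subset $I_S\subseteq S$ with $a\circ I_S=_{\mathcal A}a=_{\mathcal A}I_S\circ a$ for all $a\in S$. A unital convergent cover map $r:\mathcal S\to\mathcal T$ is a basic cover map with $r^-(b_1\circ_Tb_2)=_{\mathcal A}(r^-b_1)\circ_S(r^-b_2)$ for all $b_1,b_2\in T$ and $r^-I_T=_{\mathcal A}I_S$; equality is that of basic cover maps. A convergent cover is inductively generated if it arises from some axiom-set $(I,C)$ on $S$ and map $\delta:S\times S\to\mathcal P(S)$ as follows: $U\circ V=\bigcup\{\delta(a,b)\mid a\in U,b\in V\}$, and $\lhd$ is the basic cover generated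 by the axiom-set $(J',D')$, where $(J,D)$ is $(I,C)$ plus the axioms $a\lhd c\circ b$ for $a\in b\circ c$ and $a\lhd b\circ(c\circ d)$ for $a\in(b\circ c)\circ d$, and $(J',D')$ is $(J,D)$ plus the axioms $a\lhd D(b,j)\circ c$ for $a\in b\circ c$, $j\in J(b)$. $\mathbf{uCBCov}_i$ is the category of inductively generated convergent covers that are unital, with unital convergent cover maps. *)

theory Defs
  imports Main "HOL-Library.FuncSet"
begin

section \<open>Basic covers\<close>

text \<open>
  A set is a subset \<open>pts\<close> of an arbitrary type. The relation \<open>cov S a U\<close> (in words, \<open>a\<close> is covered
  by \<open>U\<close>) is a relation between elements of \<open>pts S\<close> and subsets of \<open>pts S\<close>, so it is false
  elsewhere.
\<close>

record 'a bcover =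
  pts :: "'a set"
  cov :: "'a \<Rightarrow> 'a set \<Rightarrow> bool"

definition covs :: "'a bcover \<Rightarrow> 'a set \<Rightarrow> 'a set \<Rightarrow> bool" where
  "covs S U V \<longleftrightarrow> (\<forall>b\<in>U. cov S b V)"

definition basic_cover :: "'a bcover \<Rightarrow> bool" where
  "basic_cover S \<longleftrightarrow>
     (\<forall>a U. cov S a U \<longrightarrow> a \<in> pts S \<and> U \<subseteq> pts S) \<and>
     (\<forall>a U. U \<subseteq> pts S \<and> a \<in> U \<longrightarrow> cov S a U) \<and>
     (\<forall>a U V. V \<subseteq> pts S \<and> cov S a U \<and> covs S U V \<longrightarrow> cov S a V)"

definition sat :: "'a bcover \<Rightarrow> 'a set \<Rightarrow> 'a set" where
  "sat S U = {a \<in> pts S. cov S a U}"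

definition eqA :: "'a bcover \<Rightarrow> 'a set \<Rightarrow> 'a set \<Rightarrow> bool" where
  "eqA S U V \<longleftrightarrow> sat S U = sat S V"

definition Sat :: "'a bcover \<Rightarrow> 'a set set" where
  "Sat S = {U. U \<subseteq> pts S \<and> U = sat S U}"

definition Sat_join :: "'a bcover \<Rightarrow> 'a set set \<Rightarrow> 'a set" where
  "Sat_join S \<U> = sat S (\<Union>\<U>)"


section \<open>Inductive generation\<close>

definition axiom_set :: "'a set \<Rightarrow> ('a \<Rightarrow> 'i set) \<Rightarrow> ('a \<Rightarrow> 'i \<Rightarrow> 'a set) \<Rightarrow> bool" where
  "axiom_set S I C \<longleftrightarrow> (\<forall>a\<in>S. \<forall>i\<in>I a. C a i \<subseteq> S)"

text \<open>
  Generation depends only on the collection of axioms, a pair \<open>(a, W)\<close> standing for the axiom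
  that \<open>a\<close> is covered by \<open>W\<close>; this makes it easy to say that axioms are added.
\<close>

definition axioms_of :: "'a set \<Rightarrow> ('a \<Rightarrow> 'i set) \<Rightarrow> ('a \<Rightarrow> 'i \<Rightarrow> 'a set) \<Rightarrow> ('a \<times> 'a set) set" where
  "axioms_of S I C = {(a, C a i) | a i. a \<in> S \<and> i \<in> I a}"

inductive gen_cov :: "'a set \<Rightarrow> ('a \<times> 'a set) set \<Rightarrow> 'a \<Rightarrow> 'a set \<Rightarrow> bool"
  for S :: "'a set" and X :: "('a \<times> 'a set) set" where
  elem: "U \<subseteq> S \<Longrightarrow> a \<in> U \<Longrightarrow> gen_cov S X a U"
| axiom: "U \<subseteq> S \<Longrightarrow> a \<in> S \<Longrightarrow> (a, W) \<in> X \<Longrightarrow> (\<forall>b\<in>W. gen_cov S X b U) \<Longrightarrow> gen_cov S X a U"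

definition generated :: "'a set \<Rightarrow> ('a \<times> 'a set) set \<Rightarrow> 'a bcover" where
  "generated S X = \<lparr>pts = S, cov = gen_cov S X\<rparr>"

text \<open>
  The index type \<open>'a set\<close> is no restriction: see \<open>axiom_set_reindex\<close>.
\<close>

definition ind_generated :: "'a bcover \<Rightarrow> bool" where
  "ind_generated S \<longleftrightarrow>
     (\<exists>(I :: 'a \<Rightarrow> 'a set set) C.
        axiom_set (pts S) I C \<and> S = generated (pts S) (axioms_of (pts S) I C))"

lemma axiom_set_reindex:
  fixes I :: "'a \<Rightarrow> 'i set"
  assumes "axiom_set S I C"
  shows "\<exists>(I' :: 'a \<Rightarrow> 'a set set) C'. axiom_set S I' C' \<and> axioms_of S I' C' = axioms_of S I C"
proof (intro exI conjI)
  show "axiom_set S (\<lambda>a. C a ` I a) (\<lambda>a W. W)"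
    using assms by (auto simp: axiom_set_def)
  show "axioms_of S (\<lambda>a. C a ` I a) (\<lambda>a W. W) = axioms_of S I C"
    by (auto simp: axioms_of_def)
qed

lemma gen_cov_subset: "gen_cov S X a U \<Longrightarrow> a \<in> S \<and> U \<subseteq> S"
  by (induction rule: gen_cov.induct) auto

lemma gen_cov_trans:
  "gen_cov S X a U \<Longrightarrow> V \<subseteq> S \<Longrightarrow> \<forall>b\<in>U. gen_cov S X b V \<Longrightarrow> gen_cov S X a V"
proof (induction rule: gen_cov.induct)
  case (axiom U a W)
  then show ?case using gen_cov.axiom[of V S a W X] by blast
qed auto

lemma generated_basic_cover: "basic_cover (generated S X)"
  unfolding basic_cover_def covs_def generated_def bcover.simps
proof (intro conjI allI impI)
  fix a U V
  assume "V \<subseteq> S \<and> gen_cov S X a U \<and> (\<forall>b\<in>U. gen_cov S X b V)"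
  then show "gen_cov S X a V" using gen_cov_trans[of S X a U V] by simp
next
  fix a U
  assume "U \<subseteq> S \<and> a \<in> U"
  then show "gen_cov S X a U" using gen_cov.elem[of U S a X] by simp
qed (simp_all add: gen_cov_subset)

lemma basic_cover_refl: "basic_cover S \<Longrightarrow> U \<subseteq> pts S \<Longrightarrow> a \<in> U \<Longrightarrow> cov S a U"
  unfolding basic_cover_def by (drule conjunct2, drule conjunct1) blast

lemma basic_cover_trans:
  assumes "basic_cover S" "V \<subseteq> pts S" "cov S a U" "covs S U V"
  shows "cov S a V"
proof -
  have "\<forall>a U V. V \<subseteq> pts S \<and> cov S a U \<and> covs S U V \<longrightarrow> cov S a V"
    using assms(1) unfolding basic_cover_def by (elim conjE)
  from this[rule_format, of V a U] show ?thesis using assms(2-4) by (simp only: simp_thms)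
qed

lemma generated_least:
  assumes S: "basic_cover S" and X: "\<And>a W. (a, W) \<in> X \<Longrightarrow> cov S a W"
    and g: "gen_cov (pts S) X a U"
  shows "cov S a U"
  using g
proof (induction rule: gen_cov.induct)
  case (elem U a)
  then show ?case using basic_cover_refl[OF S] by simp
next
  case (axiom U a W)
  have "covs S W U" using axiom by (simp add: covs_def)
  moreover have "cov S a W" using X axiom by simp
  ultimately show ?case using basic_cover_trans[OF S \<open>U \<subseteq> pts S\<close>] by simp
qed


section \<open>Basic cover maps and the category of basic covers\<close>

definition bc_map :: "'a bcover \<Rightarrow> 'b bcover \<Rightarrow> ('a \<times> 'b) set \<Rightarrow> bool" where
  "bc_map S T r \<longleftrightarrow> r \<subseteq> pts S \<times> pts T \<and>
     (\<forall>b V. cov T b V \<longrightarrow> covs S (r\<inverse> `` {b}) (r\<inverse> `` V))"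

definition bc_map_eq :: "'a bcover \<Rightarrow> 'b bcover \<Rightarrow> ('a \<times> 'b) set \<Rightarrow> ('a \<times> 'b) set \<Rightarrow> bool" where
  "bc_map_eq S T r r' \<longleftrightarrow> (\<forall>b\<in>pts T. eqA S (r\<inverse> `` {b}) (r'\<inverse> `` {b}))"

text \<open>
  A morphism is an equivalence class \<open>rels\<close> of basic cover maps under \<open>bc_map_eq\<close>, tagged with its
  source and target, so that equality of morphisms is equality in HOL.
\<close>

record ('a, 'b) mor =
  src :: "'a bcover"
  trg :: "'b bcover"
  rels :: "('a \<times> 'b) set set"

definition mor_of :: "'a bcover \<Rightarrow> 'b bcover \<Rightarrow> ('a \<times> 'b) set \<Rightarrow> ('a, 'b) mor" where
  "mor_of S T r = \<lparr>src = S, trg = T, rels = {t. bc_map S T t \<and> bc_map_eq S T t r}\<rparr>"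

definition bc_hom :: "'a bcover \<Rightarrow> 'b bcover \<Rightarrow> ('a, 'b) mor set" where
  "bc_hom S T = {mor_of S T r | r. bc_map S T r}"

definition bc_id :: "'a bcover \<Rightarrow> ('a, 'a) mor" where
  "bc_id S = mor_of S S (Id_on (pts S))"

definition bc_comp :: "('b, 'c) mor \<Rightarrow> ('a, 'b) mor \<Rightarrow> ('a, 'c) mor" (infixr "\<cdot>" 65) where
  "g \<cdot> f = \<lparr>src = src f, trg = trg g,
            rels = (\<Union>r\<in>rels f. \<Union>s\<in>rels g. rels (mor_of (src f) (trg g) (r O s)))\<rparr>"

definition bc_inv :: "('a, 'b) mor \<Rightarrow> ('b, 'a) mor" where
  "bc_inv f = (THE g. g \<in> bc_hom (trg f) (src f) \<and> g \<cdot> f = bc_id (src f) \<and> f \<cdot> g = bc_id (trg f))"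

text \<open>The morphism \<open>r\<close> determined by the requirement that the inverse image of each \<open>b\<close> under \<open>r\<close> be \<open>\<phi> b\<close>
  up to \<open>eqA\<close>.\<close>

definition mor_by :: "'a bcover \<Rightarrow> 'b bcover \<Rightarrow> ('b \<Rightarrow> 'a set) \<Rightarrow> ('a, 'b) mor" where
  "mor_by S T \<phi> = \<lparr>src = S, trg = T,
     rels = {t. bc_map S T t \<and> (\<forall>b\<in>pts T. eqA S (t\<inverse> `` {b}) (\<phi> b))}\<rparr>"


section \<open>The monoidal structure\<close>

definition tensor_axioms ::
  "'a set \<Rightarrow> ('a \<times> 'a set) set \<Rightarrow> 'b set \<Rightarrow> ('b \<times> 'b set) set \<Rightarrow> (('a \<times> 'b) \<times> ('a \<times> 'b) set) set" where
  "tensor_axioms S X T Y =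
     {((a, b), W \<times> {b}) | a b W. (a, W) \<in> X \<and> b \<in> T} \<union>
     {((a, b), {a} \<times> Z) | a b Z. a \<in> S \<and> (b, Z) \<in> Y}"

text \<open>
  The tensor product is formed from the presentation of each factor by all the axioms valid in it;
  \<open>tensor_generated\<close> shows that every other presentation gives the same result.
\<close>

definition tensor :: "'a bcover \<Rightarrow> 'b bcover \<Rightarrow> ('a \<times> 'b) bcover" (infixr "\<otimes>" 70) where
  "S \<otimes> T = generated (pts S \<times> pts T)
     (tensor_axioms (pts S) {(a, U). cov S a U} (pts T) {(b, V). cov T b V})"

lemma gen_cov_mono_axioms:
  assumes "gen_cov S X a U" and "\<And>a W. (a, W) \<in> X \<Longrightarrow> gen_cov S Y a W"
  shows "gen_cov S Y a U"
proof -
  have "cov (generated S Y) a U"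
    by (rule generated_least[OF generated_basic_cover, of X]) (use assms in \<open>simp_all add: generated_def\<close>)
  then show ?thesis by (simp add: generated_def)
qed

lemma tensor_generated:
  assumes X: "axiom_set S I C" and Y: "axiom_set T J D"
  shows "generated S (axioms_of S I C) \<otimes> generated T (axioms_of T J D) =
         generated (S \<times> T) (tensor_axioms S (axioms_of S I C) T (axioms_of T J D))"
    (is "generated S ?X \<otimes> generated T ?Y = generated _ ?Z")
proof -
  let ?M = "tensor_axioms S {(a, U). gen_cov S ?X a U} T {(b, V). gen_cov T ?Y b V}"
  have XS: "a \<in> S \<and> W \<subseteq> S \<and> gen_cov S ?X a W" if "(a, W) \<in> ?X" for a W
  proof -
    have aW: "a \<in> S" "W \<subseteq> S" using that X by (auto simp: axiom_set_def axioms_of_def)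
    have "\<forall>b\<in>W. gen_cov S ?X b W" using aW by (auto intro: gen_cov.elem)
    with aW show ?thesis using that by (blast intro: gen_cov.axiom)
  qed
  have YT: "b \<in> T \<and> W \<subseteq> T \<and> gen_cov T ?Y b W" if "(b, W) \<in> ?Y" for b W
  proof -
    have bW: "b \<in> T" "W \<subseteq> T" using that Y by (auto simp: axiom_set_def axioms_of_def)
    have "\<forall>b\<in>W. gen_cov T ?Y b W" using bW by (auto intro: gen_cov.elem)
    with bW show ?thesis using that by (blast intro: gen_cov.axiom)
  qed
  have L: "gen_cov (S \<times> T) ?Z (a, b) (U \<times> {b})" if "gen_cov S ?X a U" "b \<in> T" for a b U
    using that
  proof (induction rule: gen_cov.induct)
    case (elem U a)
    then show ?case by (auto intro!: gen_cov.elem)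
  next
    case (axiom U a W)
    have "((a, b), W \<times> {b}) \<in> ?Z" using axiom by (auto simp: tensor_axioms_def)
    moreover have "U \<times> {b} \<subseteq> S \<times> T" "(a, b) \<in> S \<times> T" using axiom by auto
    moreover have "\<forall>p\<in>W \<times> {b}. gen_cov (S \<times> T) ?Z p (U \<times> {b})" using axiom by auto
    ultimately show ?case by (metis gen_cov.axiom)
  qed
  have R: "gen_cov (S \<times> T) ?Z (a, b) ({a} \<times> V)" if "gen_cov T ?Y b V" "a \<in> S" for a b V
    using that
  proof (induction rule: gen_cov.induct)
    case (elem V b)
    then show ?case by (auto intro!: gen_cov.elem)
  next
    case (axiom V b W)
    have "((a, b), {a} \<times> W) \<in> ?Z" using axiom by (auto simp: tensor_axioms_def)
    moreover have "{a} \<times> V \<subseteq> S \<times> T" "(a, b) \<in> S \<times> T" using axiom by auto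
    moreover have "\<forall>p\<in>{a} \<times> W. gen_cov (S \<times> T) ?Z p ({a} \<times> V)" using axiom by auto
    ultimately show ?case by (metis gen_cov.axiom)
  qed
  have Z: "gen_cov (S \<times> T) ?M p W" if "(p, W) \<in> ?Z" for p W
  proof -
    from that consider
        a b U where "p = (a, b)" "W = U \<times> {b}" "(a, U) \<in> ?X" "b \<in> T"
      | a b V where "p = (a, b)" "W = {a} \<times> V" "a \<in> S" "(b, V) \<in> ?Y"
      unfolding tensor_axioms_def by blast
    then have "p \<in> S \<times> T \<and> W \<subseteq> S \<times> T \<and> (p, W) \<in> ?M"
    proof cases
      case 1
      with XS[of a U] show ?thesis by (auto simp: tensor_axioms_def)
    next
      case 2
      with YT[of b V] show ?thesis by (auto simp: tensor_axioms_def)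
    qed
    moreover from this have "\<forall>q\<in>W. gen_cov (S \<times> T) ?M q W" by (simp add: gen_cov.elem)
    ultimately show ?thesis using gen_cov.axiom[of W "S \<times> T" p W ?M] by simp
  qed
  have M: "gen_cov (S \<times> T) ?Z p W" if "(p, W) \<in> ?M" for p W
  proof -
    from that consider
        a b U where "p = (a, b)" "W = U \<times> {b}" "gen_cov S ?X a U" "b \<in> T"
      | a b V where "p = (a, b)" "W = {a} \<times> V" "a \<in> S" "gen_cov T ?Y b V"
      unfolding tensor_axioms_def by blast
    then show ?thesis by cases (simp_all add: L R)
  qed
  have "gen_cov (S \<times> T) ?M = gen_cov (S \<times> T) ?Z"
    by (intro ext iffI; erule gen_cov_mono_axioms; erule Z M)
  then show ?thesis by (simp add: tensor_def generated_def)
qed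

definition unitE :: "unit bcover" where
  "unitE = generated {()} {}"

definition tensor_mor :: "('a, 'c) mor \<Rightarrow> ('b, 'd) mor \<Rightarrow> ('a \<times> 'b, 'c \<times> 'd) mor" (infixr "\<otimes>\<^sub>m" 70) where
  "f \<otimes>\<^sub>m g = \<lparr>src = src f \<otimes> src g, trg = trg f \<otimes> trg g,
     rels = (\<Union>r\<^sub>1\<in>rels f. \<Union>r\<^sub>2\<in>rels g.
       rels (mor_by (src f \<otimes> src g) (trg f \<otimes> trg g)
               (\<lambda>(b\<^sub>1, b\<^sub>2). (r\<^sub>1\<inverse> `` {b\<^sub>1}) \<times> (r\<^sub>2\<inverse> `` {b\<^sub>2}))))\<rparr>"

definition assoc_mor ::
  "'a bcover \<Rightarrow> 'b bcover \<Rightarrow> 'c bcover \<Rightarrow> ('a \<times> ('b \<times> 'c), ('a \<times> 'b) \<times> 'c) mor" where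
  "assoc_mor S\<^sub>1 S\<^sub>2 S\<^sub>3 = mor_by (S\<^sub>1 \<otimes> (S\<^sub>2 \<otimes> S\<^sub>3)) ((S\<^sub>1 \<otimes> S\<^sub>2) \<otimes> S\<^sub>3)
     (\<lambda>((a\<^sub>1, a\<^sub>2), a\<^sub>3). {(a\<^sub>1, (a\<^sub>2, a\<^sub>3))})"

definition swap_mor :: "'a bcover \<Rightarrow> 'b bcover \<Rightarrow> ('a \<times> 'b, 'b \<times> 'a) mor" where
  "swap_mor S\<^sub>1 S\<^sub>2 = mor_by (S\<^sub>1 \<otimes> S\<^sub>2) (S\<^sub>2 \<otimes> S\<^sub>1) (\<lambda>(a\<^sub>2, a\<^sub>1). {(a\<^sub>1, a\<^sub>2)})"

definition lunit_mor :: "'a bcover \<Rightarrow> (unit \<times> 'a, 'a) mor" where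
  "lunit_mor S = mor_by (unitE \<otimes> S) S (\<lambda>a. {((), a)})"

definition runit_mor :: "'a bcover \<Rightarrow> ('a \<times> unit, 'a) mor" where
  "runit_mor S = mor_by (S \<otimes> unitE) S (\<lambda>a. {(a, ())})"


section \<open>Commutative co-monoids in the category of inductively generated basic covers\<close>

record 'a comon =
  obj :: "'a bcover"
  mult :: "('a, 'a \<times> 'a) mor"
  counit :: "('a, unit) mor"

definition comm_comonoid :: "'a comon \<Rightarrow> bool" where
  "comm_comonoid M \<longleftrightarrow>
     (let S = obj M; \<mu> = mult M; \<eta> = counit M in
        ind_generated S \<and> \<mu> \<in> bc_hom S (S \<otimes> S) \<and> \<eta> \<in> bc_hom S unitE \<and>
        assoc_mor S S S \<cdot> (bc_id S \<otimes>\<^sub>m \<mu>) \<cdot> \<mu> = (\<mu> \<otimes>\<^sub>m bc_id S) \<cdot> \<mu> \<and>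
        swap_mor S S \<cdot> \<mu> = \<mu> \<and>
        (\<eta> \<otimes>\<^sub>m bc_id S) \<cdot> \<mu> = bc_inv (lunit_mor S) \<and>
        (bc_id S \<otimes>\<^sub>m \<eta>) \<cdot> \<mu> = bc_inv (runit_mor S))"

definition comonoid_hom :: "'a comon \<Rightarrow> 'a comon \<Rightarrow> ('a, 'a) mor set" where
  "comonoid_hom M M' =
     {r \<in> bc_hom (obj M) (obj M').
        mult M' \<cdot> r = (r \<otimes>\<^sub>m r) \<cdot> mult M \<and> counit M' \<cdot> r = counit M}"


section \<open>Convergent covers\<close>

record 'a ccover =
  base :: "'a bcover"
  circ :: "'a set \<Rightarrow> 'a set \<Rightarrow> 'a set"

definition Sat_circ :: "'a ccover \<Rightarrow> 'a set \<Rightarrow> 'a set \<Rightarrow> 'a set" where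
  "Sat_circ K U V = sat (base K) (circ K U V)"

text \<open>The extensional function space makes \<open>circ\<close> exactly a binary operation on the subsets of
  \<open>pts\<close>.\<close>

definition convergent_cover :: "'a ccover \<Rightarrow> bool" where
  "convergent_cover K \<longleftrightarrow>
     (let S = base K; P = Pow (pts S); f = circ K in
        basic_cover S \<and> f \<in> P \<rightarrow>\<^sub>E (P \<rightarrow>\<^sub>E P) \<and>
        (\<forall>U\<^sub>1\<in>P. \<forall>V\<^sub>1\<in>P. \<forall>U\<^sub>2\<in>P. \<forall>V\<^sub>2\<in>P.
           covs S U\<^sub>1 V\<^sub>1 \<and> covs S U\<^sub>2 V\<^sub>2 \<longrightarrow> covs S (f U\<^sub>1 U\<^sub>2) (f V\<^sub>1 V\<^sub>2)) \<and>
        (\<forall>U\<in>P. \<forall>V\<in>P. \<forall>W\<in>P. covs S (f (f U V) W) (f U (f V W))) \<and>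
        (\<forall>U\<in>P. \<forall>V\<in>P. covs S (f U V) (f V U)) \<and>
        (\<forall>\<U> V. \<U> \<subseteq> Sat S \<and> V \<in> Sat S \<longrightarrow>
           Sat_circ K (Sat_join S \<U>) V = Sat_join S ((\<lambda>U. Sat_circ K U V) ` \<U>) \<and>
           Sat_circ K V (Sat_join S \<U>) = Sat_join S ((\<lambda>U. Sat_circ K V U) ` \<U>)))"

definition is_unit :: "'a ccover \<Rightarrow> 'a set \<Rightarrow> bool" where
  "is_unit K I \<longleftrightarrow> I \<subseteq> pts (base K) \<and>
     (\<forall>a\<in>pts (base K). eqA (base K) (circ K {a} I) {a} \<and> eqA (base K) (circ K I {a}) {a})"

definition unital :: "'a ccover \<Rightarrow> bool" where
  "unital K \<longleftrightarrow> (\<exists>I. is_unit K I)"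

text \<open>Units are unique up to \<open>eqA\<close>, so it does not matter whether a map is required to preserve
  some units or all of them.\<close>

lemma covs_sat: "covs S (sat S U) U"
  by (auto simp: covs_def sat_def)

lemma sat_subset: "sat S U \<subseteq> pts S"
  by (auto simp: sat_def)

lemma sat_least:
  assumes "basic_cover S" "V \<subseteq> pts S" "covs S U V"
  shows "sat S U \<subseteq> sat S V"
  using assms basic_cover_trans[of S V _ U] by (auto simp: sat_def)

lemma sat_increasing: "basic_cover S \<Longrightarrow> U \<subseteq> pts S \<Longrightarrow> U \<subseteq> sat S U"
  by (auto simp: sat_def basic_cover_refl)

lemma sat_idem: "basic_cover S \<Longrightarrow> U \<subseteq> pts S \<Longrightarrow> sat S (sat S U) = sat S U"
  by (meson covs_sat sat_least sat_increasing sat_subset subset_antisym)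

lemma sat_in_Sat: "basic_cover S \<Longrightarrow> U \<subseteq> pts S \<Longrightarrow> sat S U \<in> Sat S"
  by (simp add: Sat_def sat_idem sat_subset)

lemma sat_mono:
  assumes S: "basic_cover S" and "V \<subseteq> pts S" "U \<subseteq> V"
  shows "sat S U \<subseteq> sat S V"
proof (rule sat_least[OF S])
  show "covs S U V" using assms by (auto simp: covs_def intro: basic_cover_refl)
qed fact

lemma Sat_join_singletons:
  assumes S: "basic_cover S" and U: "U \<subseteq> pts S"
  shows "Sat_join S ((\<lambda>a. sat S {a}) ` U) = sat S U"
proof
  have "sat S {a} \<subseteq> sat S U" if "a \<in> U" for a using sat_mono[OF S U, of "{a}"] that by simp
  then have "(\<Union>a\<in>U. sat S {a}) \<subseteq> sat S U" by auto
  then show "Sat_join S ((\<lambda>a. sat S {a}) ` U) \<subseteq> sat S U"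
    unfolding Sat_join_def using sat_mono[OF S sat_subset] sat_idem[OF S U] by metis
  have "a \<in> sat S {a}" if "a \<in> U" for a using sat_increasing[OF S, of "{a}"] that U by auto
  then have "U \<subseteq> (\<Union>a\<in>U. sat S {a})" by auto
  then show "sat S U \<subseteq> Sat_join S ((\<lambda>a. sat S {a}) ` U)"
    unfolding Sat_join_def by (intro sat_mono[OF S]) (auto simp: sat_def)
qed

lemma Sat_circ_sat:
  assumes K: "convergent_cover K" and U: "U \<subseteq> pts (base K)" and V: "V \<subseteq> pts (base K)"
  shows "Sat_circ K (sat (base K) U) (sat (base K) V) = sat (base K) (circ K U V)"
proof -
  let ?S = "base K"
  have S: "basic_cover ?S" and
    f: "circ K \<in> Pow (pts ?S) \<rightarrow>\<^sub>E (Pow (pts ?S) \<rightarrow>\<^sub>E Pow (pts ?S))" and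
    c: "\<And>U\<^sub>1 V\<^sub>1 U\<^sub>2 V\<^sub>2. \<lbrakk>U\<^sub>1 \<subseteq> pts ?S; V\<^sub>1 \<subseteq> pts ?S; U\<^sub>2 \<subseteq> pts ?S; V\<^sub>2 \<subseteq> pts ?S;
       covs ?S U\<^sub>1 V\<^sub>1; covs ?S U\<^sub>2 V\<^sub>2\<rbrakk> \<Longrightarrow> covs ?S (circ K U\<^sub>1 U\<^sub>2) (circ K V\<^sub>1 V\<^sub>2)"
    using K unfolding convergent_cover_def Let_def by simp_all
  have cl: "circ K A B \<subseteq> pts ?S" if "A \<subseteq> pts ?S" "B \<subseteq> pts ?S" for A B
    using PiE_mem[OF PiE_mem[OF f, of A], of B] that by auto
  have le: "covs ?S A (sat ?S A)" if "A \<subseteq> pts ?S" for A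
    using basic_cover_refl[OF S sat_subset, of _ A] sat_increasing[OF S that]
    by (auto simp: covs_def)
  show ?thesis unfolding Sat_circ_def
    by (intro subset_antisym sat_least S cl c sat_subset U V covs_sat le)
qed

lemma unit_sat:
  assumes K: "convergent_cover K" and J: "is_unit K J" and U: "U \<subseteq> pts (base K)"
  shows "sat (base K) (circ K U J) = sat (base K) U" "sat (base K) (circ K J U) = sat (base K) U"
proof -
  let ?S = "base K" and ?F = "(\<lambda>a. sat (base K) {a}) ` U"
  have S: "basic_cover ?S" and
    d: "\<And>\<U> V. \<U> \<subseteq> Sat ?S \<Longrightarrow> V \<in> Sat ?S \<Longrightarrow>
          Sat_circ K (Sat_join ?S \<U>) V = Sat_join ?S ((\<lambda>U. Sat_circ K U V) ` \<U>) \<and>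
          Sat_circ K V (Sat_join ?S \<U>) = Sat_join ?S ((\<lambda>U. Sat_circ K V U) ` \<U>)"
    using K unfolding convergent_cover_def Let_def by simp_all
  have J': "J \<subseteq> pts ?S" using J by (simp add: is_unit_def)
  have u: "Sat_circ K (sat ?S {a}) (sat ?S J) = sat ?S {a}"
          "Sat_circ K (sat ?S J) (sat ?S {a}) = sat ?S {a}" if "a \<in> U" for a
  proof -
    have a: "a \<in> pts ?S" using that U by blast
    then have a': "{a} \<subseteq> pts ?S" by simp
    show "Sat_circ K (sat ?S {a}) (sat ?S J) = sat ?S {a}"
      unfolding Sat_circ_sat[OF K a' J'] using J a by (simp add: is_unit_def eqA_def)
    show "Sat_circ K (sat ?S J) (sat ?S {a}) = sat ?S {a}"
      unfolding Sat_circ_sat[OF K J' a'] using J a by (simp add: is_unit_def eqA_def)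
  qed
  have F: "?F \<subseteq> Sat ?S" using sat_in_Sat[OF S] U by (auto simp: subset_iff)
  note D = d[OF F sat_in_Sat[OF S J'], unfolded Sat_join_singletons[OF S U] image_image
      Sat_circ_sat[OF K U J'] Sat_circ_sat[OF K J' U]]
  have "(\<lambda>a. Sat_circ K (sat ?S {a}) (sat ?S J)) ` U = ?F"
       "(\<lambda>a. Sat_circ K (sat ?S J) (sat ?S {a})) ` U = ?F"
    using u by (auto intro!: image_cong)
  then show "sat ?S (circ K U J) = sat ?S U" "sat ?S (circ K J U) = sat ?S U"
    using D Sat_join_singletons[OF S U] by simp_all
qed

lemma is_unit_unique:
  assumes K: "convergent_cover K" and I: "is_unit K I" and J: "is_unit K J"
  shows "eqA (base K) I J"
  using unit_sat(1)[OF K J, of I] unit_sat(2)[OF K I, of J] I J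
  by (simp add: eqA_def is_unit_def)

definition ucc_map :: "'a ccover \<Rightarrow> 'b ccover \<Rightarrow> ('a \<times> 'b) set \<Rightarrow> bool" where
  "ucc_map K L r \<longleftrightarrow> bc_map (base K) (base L) r \<and>
     (\<forall>b\<^sub>1\<in>pts (base L). \<forall>b\<^sub>2\<in>pts (base L).
        eqA (base K) (r\<inverse> `` circ L {b\<^sub>1} {b\<^sub>2}) (circ K (r\<inverse> `` {b\<^sub>1}) (r\<inverse> `` {b\<^sub>2}))) \<and>
     (\<forall>I J. is_unit K I \<and> is_unit L J \<longrightarrow> eqA (base K) (r\<inverse> `` J) I)"

definition ucc_hom :: "'a ccover \<Rightarrow> 'b ccover \<Rightarrow> ('a, 'b) mor set" where
  "ucc_hom K L = {mor_of (base K) (base L) r | r. ucc_map K L r}"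

definition comm_assoc_axioms ::
  "'a set \<Rightarrow> ('a set \<Rightarrow> 'a set \<Rightarrow> 'a set) \<Rightarrow> ('a \<times> 'a set) set \<Rightarrow> ('a \<times> 'a set) set" where
  "comm_assoc_axioms S f X = X \<union>
     {(a, f {c} {b}) | a b c. b \<in> S \<and> c \<in> S \<and> a \<in> f {b} {c}} \<union>
     {(a, f {b} (f {c} {d})) | a b c d. b \<in> S \<and> c \<in> S \<and> d \<in> S \<and> a \<in> f (f {b} {c}) {d}}"

definition local_axioms ::
  "'a set \<Rightarrow> ('a set \<Rightarrow> 'a set \<Rightarrow> 'a set) \<Rightarrow> ('a \<times> 'a set) set \<Rightarrow> ('a \<times> 'a set) set" where
  "local_axioms S f Y = Y \<union>
     {(a, f W {c}) | a b c W. (b, W) \<in> Y \<and> c \<in> S \<and> a \<in> f {b} {c}}"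

definition ind_generated_cc :: "'a ccover \<Rightarrow> bool" where
  "ind_generated_cc K \<longleftrightarrow> convergent_cover K \<and>
     (let S = pts (base K); f = circ K in
      \<exists>(I :: 'a \<Rightarrow> 'a set set) C (\<delta> :: 'a \<Rightarrow> 'a \<Rightarrow> 'a set).
        axiom_set S I C \<and> (\<forall>a\<in>S. \<forall>b\<in>S. \<delta> a b \<subseteq> S) \<and>
        (\<forall>U V. U \<subseteq> S \<and> V \<subseteq> S \<longrightarrow> f U V = (\<Union>a\<in>U. \<Union>b\<in>V. \<delta> a b)) \<and>
        base K = generated S (local_axioms S f (comm_assoc_axioms S f (axioms_of S I C))))"


section \<open>Equivalence of categories\<close>

text \<open>Hom-sets need not be disjoint, so the action of a functor on arrows takes the source and the target
  as arguments.\<close>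

record ('o, 'm) cat =
  Obj :: "'o set"
  Hom :: "'o \<Rightarrow> 'o \<Rightarrow> 'm set"
  Idt :: "'o \<Rightarrow> 'm"
  Cmp :: "'m \<Rightarrow> 'm \<Rightarrow> 'm"

definition category :: "('o, 'm) cat \<Rightarrow> bool" where
  "category \<C> \<longleftrightarrow>
     (\<forall>A\<in>Obj \<C>. Idt \<C> A \<in> Hom \<C> A A) \<and>
     (\<forall>A\<in>Obj \<C>. \<forall>B\<in>Obj \<C>. \<forall>C\<in>Obj \<C>. \<forall>f\<in>Hom \<C> A B. \<forall>g\<in>Hom \<C> B C. Cmp \<C> g f \<in> Hom \<C> A C) \<and>
     (\<forall>A\<in>Obj \<C>. \<forall>B\<in>Obj \<C>. \<forall>f\<in>Hom \<C> A B. Cmp \<C> f (Idt \<C> A) = f \<and> Cmp \<C> (Idt \<C> B) f = f) \<and>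
     (\<forall>A\<in>Obj \<C>. \<forall>B\<in>Obj \<C>. \<forall>C\<in>Obj \<C>. \<forall>D\<in>Obj \<C>.
        \<forall>f\<in>Hom \<C> A B. \<forall>g\<in>Hom \<C> B C. \<forall>h\<in>Hom \<C> C D.
          Cmp \<C> h (Cmp \<C> g f) = Cmp \<C> (Cmp \<C> h g) f)"

record ('o, 'm, 'p, 'n) funct =
  omap :: "'o \<Rightarrow> 'p"
  amap :: "'o \<Rightarrow> 'o \<Rightarrow> 'm \<Rightarrow> 'n"

definition is_functor :: "('o, 'm) cat \<Rightarrow> ('p, 'n) cat \<Rightarrow> ('o, 'm, 'p, 'n) funct \<Rightarrow> bool" where
  "is_functor \<C> \<D> F \<longleftrightarrow>
     (\<forall>A\<in>Obj \<C>. omap F A \<in> Obj \<D>) \<and>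
     (\<forall>A\<in>Obj \<C>. \<forall>B\<in>Obj \<C>. \<forall>f\<in>Hom \<C> A B. amap F A B f \<in> Hom \<D> (omap F A) (omap F B)) \<and>
     (\<forall>A\<in>Obj \<C>. amap F A A (Idt \<C> A) = Idt \<D> (omap F A)) \<and>
     (\<forall>A\<in>Obj \<C>. \<forall>B\<in>Obj \<C>. \<forall>C\<in>Obj \<C>. \<forall>f\<in>Hom \<C> A B. \<forall>g\<in>Hom \<C> B C.
        amap F A C (Cmp \<C> g f) = Cmp \<D> (amap F B C g) (amap F A B f))"

definition id_funct :: "('o, 'm, 'o, 'm) funct" where
  "id_funct = \<lparr>omap = (\<lambda>A. A), amap = (\<lambda>A B f. f)\<rparr>"

definition comp_funct ::
  "('p, 'n, 'q, 'k) funct \<Rightarrow> ('o, 'm, 'p, 'n) funct \<Rightarrow> ('o, 'm, 'q, 'k) funct" where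
  "comp_funct G F = \<lparr>omap = (\<lambda>A. omap G (omap F A)),
     amap = (\<lambda>A B f. amap G (omap F A) (omap F B) (amap F A B f))\<rparr>"

definition is_iso :: "('o, 'm) cat \<Rightarrow> 'o \<Rightarrow> 'o \<Rightarrow> 'm \<Rightarrow> bool" where
  "is_iso \<C> A B f \<longleftrightarrow> f \<in> Hom \<C> A B \<and>
     (\<exists>g\<in>Hom \<C> B A. Cmp \<C> g f = Idt \<C> A \<and> Cmp \<C> f g = Idt \<C> B)"

definition naturally_isomorphic ::
  "('o, 'm) cat \<Rightarrow> ('p, 'n) cat \<Rightarrow> ('o, 'm, 'p, 'n) funct \<Rightarrow> ('o, 'm, 'p, 'n) funct \<Rightarrow> bool" where
  "naturally_isomorphic \<C> \<D> F G \<longleftrightarrow>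
     (\<exists>\<tau>. (\<forall>A\<in>Obj \<C>. is_iso \<D> (omap F A) (omap G A) (\<tau> A)) \<and>
          (\<forall>A\<in>Obj \<C>. \<forall>B\<in>Obj \<C>. \<forall>f\<in>Hom \<C> A B.
             Cmp \<D> (\<tau> B) (amap F A B f) = Cmp \<D> (amap G A B f) (\<tau> A)))"

definition equivalent_categories :: "('o, 'm) cat \<Rightarrow> ('p, 'n) cat \<Rightarrow> bool" where
  "equivalent_categories \<C> \<D> \<longleftrightarrow> category \<C> \<and> category \<D> \<and>
     (\<exists>F G. is_functor \<C> \<D> F \<and> is_functor \<D> \<C> G \<and>
        naturally_isomorphic \<C> \<C> (comp_funct G F) id_funct \<and>
        naturally_isomorphic \<D> \<D> (comp_funct F G) id_funct)"


section \<open>The two categories\<close>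

definition uCBCov_i :: "('a ccover, ('a, 'a) mor) cat" where
  "uCBCov_i = \<lparr>Obj = {K. ind_generated_cc K \<and> unital K}, Hom = ucc_hom,
     Idt = (\<lambda>K. bc_id (base K)), Cmp = bc_comp\<rparr>"

definition coCMon_BCov_i :: "('a comon, ('a, 'a) mor) cat" where
  "coCMon_BCov_i = \<lparr>Obj = {M. comm_comonoid M}, Hom = comonoid_hom,
     Idt = (\<lambda>M. bc_id (obj M)), Cmp = bc_comp\<rparr>"

end

theory Submission
  imports Defs
begin

text \<open>
  A basic cover map is determined, up to equality of maps, by the inverse images of points, and
  those may be any sets \<open>\<phi> b\<close> such that \<open>b\<close> covered by \<open>V\<close> makes \<open>\<phi> b\<close> covered by the union of
  \<open>\<phi>\<close> over \<open>V\<close> (\<open>preserves_cover\<close>). In these terms composition is a union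
  (\<open>mor_by_comp\<close>), the tensor product of maps is a product of sets (\<open>mor_by_tensor\<close>), and equality of
  morphisms is pointwise \<^const>\<open>eqA\<close> (\<open>mor_by_eq_iff\<close>). Since the cover of \<open>S \<otimes> T\<close> is generated
  by covers in one coordinate at a time, a map into it is exactly a function of two points that
  preserves covers in each argument separately (\<open>preserves_cover_tensorI\<close>, \<open>covs_tensor\<close>).

  A comultiplication on \<open>S\<close> is therefore a function \<open>m\<close> assigning to a pair of points the subset
  \<open>m (a, b)\<close>, which is to be read as \<open>a \<circ> b\<close>; extended to subsets by unions it is an operation
  compatible with the cover. A counit is a subset \<open>I\<close> of \<open>S\<close>. Evaluating the comonoid diagrams at
  points turns them into associativity, commutativity and unit laws for this operation up to
  \<^const>\<open>eqA\<close> (\<open>comm_comonoid_iff_laws\<close>). These are the laws of a unital convergent cover: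
  distributivity over joins is compatibility with the cover together with preservation of unions, and
  an inductively generated convergent cover has a \<open>\<circ>\<close> that preserves unions by construction. Its cover
  is inductively generated; conversely, if a cover is generated by some axioms and \<open>m\<close> is compatible
  with it and lawful, then the extra axioms in the definition of an inductively generated
  convergent cover already hold, so adding them changes nothing
  (\<open>ind_generated_cc_of_laws\<close>). In the same way, the two conditions on a map of convergent covers are
  the two conditions on a comonoid morphism, read at points (\<open>ucc_map_iff\<close>).

  So \<open>comonoid_of\<close> and \<open>ccover_of\<close> act as the identity on morphisms. The composite
  \<open>comonoid_of (ccover_of M)\<close> is \<open>M\<close> itself, because morphisms are equivalence classes; the other
  composite changes \<open>a \<circ> b\<close> within its \<^const>\<open>eqA\<close>-class, and the identity relation is an
  isomorphism. This is the situation of \<open>equivalent_via_equal_homs\<close>.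
\<close>

section \<open>Covers of sets by sets\<close>

lemma covs_subset:
  assumes "basic_cover S" "U \<subseteq> V" "V \<subseteq> pts S"
  shows "covs S U V"
  unfolding covs_def using basic_cover_refl[OF assms(1,3)] assms(2) by auto

lemma covs_trans:
  assumes "basic_cover S" "covs S U V" "covs S V W" "W \<subseteq> pts S"
  shows "covs S U W"
  using basic_cover_trans[OF assms(1,4) _ assms(3)] assms(2) by (simp add: covs_def[of S U])

lemma covs_UN: "(\<And>x. x \<in> A \<Longrightarrow> covs S (\<phi> x) V) \<Longrightarrow> covs S (\<Union>(\<phi> ` A)) V"
  by (auto simp: covs_def)

lemma cov_pts:
  assumes "basic_cover S" "cov S a U"
  shows "a \<in> pts S \<and> U \<subseteq> pts S"
proof -
  have "\<forall>a U. cov S a U \<longrightarrow> a \<in> pts S \<and> U \<subseteq> pts S"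
    using assms(1) unfolding basic_cover_def by (elim conjE)
  then show ?thesis using assms(2) by blast
qed

lemma eqA_iff_covs:
  assumes S: "basic_cover S" and U: "U \<subseteq> pts S" and V: "V \<subseteq> pts S"
  shows "eqA S U V \<longleftrightarrow> covs S U V \<and> covs S V U"
proof
  assume "eqA S U V"
  then show "covs S U V \<and> covs S V U"
    using sat_increasing[OF S U] sat_increasing[OF S V] unfolding eqA_def covs_def sat_def by blast
next
  assume "covs S U V \<and> covs S V U"
  then show "eqA S U V"
    unfolding eqA_def using sat_least[OF S] U V by (meson subset_antisym)
qed

lemma eqA_refl: "eqA S U U"
  and eqA_trans: "eqA S U V \<Longrightarrow> eqA S V W \<Longrightarrow> eqA S U W"
  by (simp_all add: eqA_def)

lemma eqA_sat: "basic_cover S \<Longrightarrow> U \<subseteq> pts S \<Longrightarrow> eqA S (sat S U) U"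
  by (simp add: eqA_def sat_idem)

lemma eqA_UN:
  assumes S: "basic_cover S"
    and \<phi>: "\<And>x. x \<in> A \<Longrightarrow> \<phi> x \<subseteq> pts S" and \<psi>: "\<And>x. x \<in> A \<Longrightarrow> \<psi> x \<subseteq> pts S"
    and e: "\<And>x. x \<in> A \<Longrightarrow> eqA S (\<phi> x) (\<psi> x)"
  shows "eqA S (\<Union>(\<phi> ` A)) (\<Union>(\<psi> ` A))"
proof -
  have P: "\<Union>(\<phi> ` A) \<subseteq> pts S" and Q: "\<Union>(\<psi> ` A) \<subseteq> pts S" using \<phi> \<psi> by (simp_all add: UN_least)
  have "covs S (\<Union>(\<phi> ` A)) (\<Union>(\<psi> ` A))"
  proof (rule covs_UN)
    fix x assume x: "x \<in> A"
    then have "covs S (\<phi> x) (\<psi> x)" using e eqA_iff_covs[OF S \<phi> \<psi>] by simp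
    then show "covs S (\<phi> x) (\<Union>(\<psi> ` A))"
      by (rule covs_trans[OF S _ covs_subset[OF S UN_upper[OF x] Q] Q])
  qed
  moreover have "covs S (\<Union>(\<psi> ` A)) (\<Union>(\<phi> ` A))"
  proof (rule covs_UN)
    fix x assume x: "x \<in> A"
    then have "covs S (\<psi> x) (\<phi> x)" using e eqA_iff_covs[OF S \<phi> \<psi>] by simp
    then show "covs S (\<psi> x) (\<Union>(\<phi> ` A))"
      by (rule covs_trans[OF S _ covs_subset[OF S UN_upper[OF x] P] P])
  qed
  ultimately show ?thesis by (simp add: eqA_iff_covs[OF S P Q])
qed


section \<open>Morphisms as functions from points to subsets\<close>

text \<open>
  The functions \<open>b \<mapsto> r\<inverse> `` {b}\<close> of basic cover maps \<open>r\<close>. Working with them instead of relations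
  makes a morphism a single function, whose only ambiguity is \<^const>\<open>eqA\<close> at each point.
\<close>

definition preserves_cover :: "'a bcover \<Rightarrow> 'b bcover \<Rightarrow> ('b \<Rightarrow> 'a set) \<Rightarrow> bool" where
  "preserves_cover S T \<phi> \<longleftrightarrow> (\<forall>b\<in>pts T. \<phi> b \<subseteq> pts S) \<and>
     (\<forall>b V. cov T b V \<longrightarrow> covs S (\<phi> b) (\<Union>(\<phi> ` V)))"

lemma preserves_cover_pts: "preserves_cover S T \<phi> \<Longrightarrow> b \<in> pts T \<Longrightarrow> \<phi> b \<subseteq> pts S"
  by (simp add: preserves_cover_def)

lemma preserves_cover_UN_pts: "preserves_cover S T \<phi> \<Longrightarrow> V \<subseteq> pts T \<Longrightarrow> \<Union>(\<phi> ` V) \<subseteq> pts S"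
  by (rule UN_least) (erule preserves_cover_pts, erule (1) subsetD)

lemma preserves_cover_cov:
  "preserves_cover S T \<phi> \<Longrightarrow> cov T b V \<Longrightarrow> covs S (\<phi> b) (\<Union>(\<phi> ` V))"
  by (simp add: preserves_cover_def)

lemma preserves_cover_covs:
  "preserves_cover S T \<phi> \<Longrightarrow> covs T U V \<Longrightarrow> covs S (\<Union>(\<phi> ` U)) (\<Union>(\<phi> ` V))"
  by (intro covs_UN preserves_cover_cov) (auto simp: covs_def[of T])

lemma preserves_cover_eqA:
  assumes "basic_cover S" "basic_cover T" "preserves_cover S T \<phi>" "U \<subseteq> pts T" "V \<subseteq> pts T" "eqA T U V"
  shows "eqA S (\<Union>(\<phi> ` U)) (\<Union>(\<phi> ` V))"
  using assms preserves_cover_covs[OF assms(3)]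
  by (simp add: eqA_iff_covs preserves_cover_UN_pts)

lemma preserves_cover_cong:
  assumes S: "basic_cover S" and T: "basic_cover T" and \<phi>: "preserves_cover S T \<phi>"
    and P: "\<And>b. b \<in> pts T \<Longrightarrow> \<psi> b \<subseteq> pts S" and e: "\<And>b. b \<in> pts T \<Longrightarrow> eqA S (\<psi> b) (\<phi> b)"
  shows "preserves_cover S T \<psi>"
  unfolding preserves_cover_def
proof (intro conjI allI impI ballI P)
  fix b V assume b: "cov T b V"
  note bV = cov_pts[OF T b]
  have \<phi>V: "\<phi> b \<subseteq> pts S" "\<Union>(\<phi> ` V) \<subseteq> pts S"
    using bV by (simp_all add: preserves_cover_pts[OF \<phi>] preserves_cover_UN_pts[OF \<phi>])
  have \<psi>V: "\<Union>(\<psi> ` V) \<subseteq> pts S" using bV P by (intro UN_least) auto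
  have "eqA S (\<Union>(\<psi> ` V)) (\<Union>(\<phi> ` V))"
    using bV by (intro eqA_UN[OF S] e P preserves_cover_pts[OF \<phi>]) auto
  then have "covs S (\<Union>(\<phi> ` V)) (\<Union>(\<psi> ` V))"
    by (simp add: eqA_iff_covs[OF S \<psi>V \<phi>V(2)])
  moreover have "covs S (\<psi> b) (\<phi> b)"
    using e[of b] bV by (simp add: eqA_iff_covs[OF S P \<phi>V(1)])
  ultimately show "covs S (\<psi> b) (\<Union>(\<psi> ` V))"
    using covs_trans[OF S covs_trans[OF S _ preserves_cover_cov[OF \<phi> b] \<phi>V(2)] _ \<psi>V] by simp
qed

lemma preserves_cover_id: "basic_cover S \<Longrightarrow> preserves_cover S S (\<lambda>a. {a})"
  by (simp add: preserves_cover_def covs_def)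

lemma preserves_cover_comp:
  assumes T: "basic_cover T" and U: "basic_cover U"
    and \<phi>: "preserves_cover S T \<phi>" and \<psi>: "preserves_cover T U \<psi>"
  shows "preserves_cover S U (\<lambda>c. \<Union>(\<phi> ` \<psi> c))"
proof -
  have "covs S (\<Union>(\<phi> ` \<psi> c)) (\<Union>c\<in>W. \<Union>(\<phi> ` \<psi> c))" if "cov U c W" for c W
  proof -
    have "(\<Union>c\<in>W. \<Union>(\<phi> ` \<psi> c)) = \<Union>(\<phi> ` \<Union>(\<psi> ` W))" by blast
    moreover have "covs T (\<psi> c) (\<Union>(\<psi> ` W))" using \<psi> that by (simp add: preserves_cover_def)
    ultimately show ?thesis using preserves_cover_covs[OF \<phi>] by metis
  qed
  then show ?thesis
    using preserves_cover_UN_pts[OF \<phi> preserves_cover_pts[OF \<psi>]]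
    by (simp add: preserves_cover_def)
qed

lemma bc_map_iff_preserves_cover:
  assumes T: "basic_cover T"
  shows "bc_map S T r \<longleftrightarrow> r \<subseteq> pts S \<times> pts T \<and> preserves_cover S T (\<lambda>b. r\<inverse> `` {b})"
proof -
  have *: "(\<Union>b\<in>V. r\<inverse> `` {b}) = r\<inverse> `` V" for V by blast
  have **: "r \<subseteq> pts S \<times> pts T \<Longrightarrow> \<forall>b\<in>pts T. r\<inverse> `` {b} \<subseteq> pts S" by blast
  show ?thesis unfolding bc_map_def preserves_cover_def *
    by (rule iffI; elim conjE; intro conjI; (assumption | erule **))
qed

definition rel_of :: "'b bcover \<Rightarrow> ('b \<Rightarrow> 'a set) \<Rightarrow> ('a \<times> 'b) set" where
  "rel_of T \<phi> = {(a, b). b \<in> pts T \<and> a \<in> \<phi> b}"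

lemma rel_of_preimage: "b \<in> pts T \<Longrightarrow> (rel_of T \<phi>)\<inverse> `` {b} = \<phi> b"
  by (auto simp: rel_of_def)

lemma bc_map_rel_of:
  assumes T: "basic_cover T" and \<phi>: "preserves_cover S T \<phi>"
  shows "bc_map S T (rel_of T \<phi>)"
proof -
  have *: "(\<Union>b\<in>V. (rel_of T \<phi>)\<inverse> `` {b}) = \<Union>(\<phi> ` V)" if "V \<subseteq> pts T" for V
    using that by (auto simp: rel_of_def)
  have "rel_of T \<phi> \<subseteq> pts S \<times> pts T"
    using preserves_cover_pts[OF \<phi>] by (auto simp: rel_of_def)
  moreover have "preserves_cover S T (\<lambda>b. (rel_of T \<phi>)\<inverse> `` {b})"
    using \<phi> cov_pts[OF T] by (simp add: preserves_cover_def rel_of_preimage *)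
  ultimately show ?thesis by (simp add: bc_map_iff_preserves_cover[OF T])
qed

lemma mor_of_eq_mor_by: "mor_of S T r = mor_by S T (\<lambda>b. r\<inverse> `` {b})"
  by (simp add: mor_of_def mor_by_def bc_map_eq_def)

lemma src_mor_by [simp]: "src (mor_by S T \<phi>) = S"
  and trg_mor_by [simp]: "trg (mor_by S T \<phi>) = T"
  by (simp_all add: mor_by_def)

lemma mor_by_cong:
  assumes "\<And>b. b \<in> pts T \<Longrightarrow> eqA S (\<phi> b) (\<psi> b)"
  shows "mor_by S T \<phi> = mor_by S T \<psi>"
  using assms unfolding mor_by_def eqA_def by (auto intro!: Collect_cong)

lemma rel_of_in_rels:
  assumes T: "basic_cover T" and \<phi>: "preserves_cover S T \<phi>"
  shows "rel_of T \<phi> \<in> rels (mor_by S T \<phi>)"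
  using bc_map_rel_of[OF assms] by (simp add: mor_by_def rel_of_preimage eqA_refl)

lemma in_rels_mor_by:
  "r \<in> rels (mor_by S T \<phi>) \<longleftrightarrow> bc_map S T r \<and> (\<forall>b\<in>pts T. eqA S (r\<inverse> `` {b}) (\<phi> b))"
  by (simp add: mor_by_def)

lemma mor_by_eq_iff:
  assumes T: "basic_cover T" and \<phi>: "preserves_cover S T \<phi>"
  shows "mor_by S T \<phi> = mor_by S T \<psi> \<longleftrightarrow> (\<forall>b\<in>pts T. eqA S (\<phi> b) (\<psi> b))"
proof
  assume "mor_by S T \<phi> = mor_by S T \<psi>"
  then have "rel_of T \<phi> \<in> rels (mor_by S T \<psi>)" using rel_of_in_rels[OF T \<phi>] by simp
  then show "\<forall>b\<in>pts T. eqA S (\<phi> b) (\<psi> b)" by (simp add: in_rels_mor_by rel_of_preimage)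
qed (simp add: mor_by_cong)

lemma mor_by_in_bc_hom:
  assumes T: "basic_cover T" and \<phi>: "preserves_cover S T \<phi>"
  shows "mor_by S T \<phi> \<in> bc_hom S T"
proof -
  have "mor_by S T \<phi> = mor_of S T (rel_of T \<phi>)"
    unfolding mor_of_eq_mor_by by (rule mor_by_cong) (simp add: rel_of_preimage eqA_refl)
  then show ?thesis using bc_map_rel_of[OF assms] by (auto simp: bc_hom_def)
qed

text \<open>
  Every morphism is a \<^const>\<open>mor_by\<close>, so identities between morphisms reduce to identities
  between set-valued functions.
\<close>

lemma bc_hom_cases:
  assumes T: "basic_cover T" and f: "f \<in> bc_hom S T"
  obtains \<phi> where "preserves_cover S T \<phi>" "f = mor_by S T \<phi>"
  using f bc_map_iff_preserves_cover[OF T] unfolding bc_hom_def mor_of_eq_mor_by by blast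

lemma bc_id_eq: "bc_id S = mor_by S S (\<lambda>a. {a})"
  unfolding bc_id_def mor_of_eq_mor_by by (rule mor_by_cong) (auto simp: eqA_def)

text \<open>
  The definition ranges over all composites \<open>r O s\<close> of representatives. They give the same class:
  changing \<open>s\<close> changes its inverse images within \<^const>\<open>eqA\<close>-classes, which the map \<open>r\<close> respects, and changing \<open>r\<close>
  changes a union memberwise.
\<close>

lemma mor_by_comp:
  assumes S: "basic_cover S" and T: "basic_cover T" and U: "basic_cover U"
    and \<phi>: "preserves_cover S T \<phi>" and \<psi>: "preserves_cover T U \<psi>"
  shows "mor_by T U \<psi> \<cdot> mor_by S T \<phi> = mor_by S U (\<lambda>c. \<Union>(\<phi> ` \<psi> c))"
proof -
  have *: "mor_of S U (r O s) = mor_by S U (\<lambda>c. \<Union>(\<phi> ` \<psi> c))"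
    if r: "r \<in> rels (mor_by S T \<phi>)" and s: "s \<in> rels (mor_by T U \<psi>)" for r s
    unfolding mor_of_eq_mor_by
  proof (rule mor_by_cong)
    fix c assume c: "c \<in> pts U"
    let ?r = "\<lambda>b. r\<inverse> `` {b}"
    have r': "preserves_cover S T ?r" and s': "preserves_cover T U (\<lambda>c. s\<inverse> `` {c})"
      using r s by (simp_all add: in_rels_mor_by bc_map_iff_preserves_cover T U)
    have sc: "s\<inverse> `` {c} \<subseteq> pts T" "\<psi> c \<subseteq> pts T"
      using preserves_cover_pts[OF s' c] preserves_cover_pts[OF \<psi> c] by auto
    have "(r O s)\<inverse> `` {c} = \<Union>(?r ` (s\<inverse> `` {c}))" by blast
    moreover have "eqA S (\<Union>(?r ` (s\<inverse> `` {c}))) (\<Union>(?r ` \<psi> c))"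
      by (rule preserves_cover_eqA[OF S T r']) (use s c sc in \<open>simp_all add: in_rels_mor_by\<close>)
    moreover have "eqA S (\<Union>(?r ` \<psi> c)) (\<Union>(\<phi> ` \<psi> c))"
      by (rule eqA_UN[OF S])
        (use r sc preserves_cover_pts[OF r'] preserves_cover_pts[OF \<phi>] in
          \<open>auto simp: in_rels_mor_by subset_iff\<close>)
    ultimately show "eqA S ((r O s)\<inverse> `` {c}) (\<Union>(\<phi> ` \<psi> c))" using eqA_trans by metis
  qed
  have "rels (mor_by T U \<psi> \<cdot> mor_by S T \<phi>) = rels (mor_by S U (\<lambda>c. \<Union>(\<phi> ` \<psi> c)))"
    using * rel_of_in_rels[OF T \<phi>] rel_of_in_rels[OF U \<psi>]
    by (simp add: bc_comp_def) blast
  then show ?thesis by (simp add: bc_comp_def mor_by_def)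
qed

lemma bc_comp_in_hom:
  assumes S: "basic_cover S" and T: "basic_cover T" and U: "basic_cover U"
    and f: "f \<in> bc_hom S T" and g: "g \<in> bc_hom T U"
  shows "g \<cdot> f \<in> bc_hom S U"
proof -
  from f obtain \<phi> where \<phi>: "preserves_cover S T \<phi>" "f = mor_by S T \<phi>"
    by (rule bc_hom_cases[OF T])
  from g obtain \<psi> where \<psi>: "preserves_cover T U \<psi>" "g = mor_by T U \<psi>"
    by (rule bc_hom_cases[OF U])
  show ?thesis
    unfolding \<phi>(2) \<psi>(2) mor_by_comp[OF S T U \<phi>(1) \<psi>(1)]
    by (rule mor_by_in_bc_hom[OF U preserves_cover_comp[OF T U \<phi>(1) \<psi>(1)]])
qed

lemma bc_id_in_hom: "basic_cover S \<Longrightarrow> bc_id S \<in> bc_hom S S"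
  by (simp add: bc_id_eq mor_by_in_bc_hom preserves_cover_id)

lemma bc_comp_id:
  assumes S: "basic_cover S" and T: "basic_cover T" and f: "f \<in> bc_hom S T"
  shows "f \<cdot> bc_id S = f" "bc_id T \<cdot> f = f"
proof -
  from f obtain \<phi> where \<phi>: "preserves_cover S T \<phi>" "f = mor_by S T \<phi>"
    by (rule bc_hom_cases[OF T])
  show "f \<cdot> bc_id S = f" "bc_id T \<cdot> f = f"
    by (simp_all add: \<phi>(2) bc_id_eq mor_by_comp[OF S S T preserves_cover_id[OF S] \<phi>(1)]
        mor_by_comp[OF S T T \<phi>(1) preserves_cover_id[OF T]])
qed

lemma bc_comp_assoc:
  assumes S: "basic_cover S" and T: "basic_cover T" and U: "basic_cover U" and V: "basic_cover V"
    and f: "f \<in> bc_hom S T" and g: "g \<in> bc_hom T U" and h: "h \<in> bc_hom U V"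
  shows "h \<cdot> (g \<cdot> f) = (h \<cdot> g) \<cdot> f"
proof -
  from f obtain \<phi> where \<phi>: "preserves_cover S T \<phi>" "f = mor_by S T \<phi>"
    by (rule bc_hom_cases[OF T])
  from g obtain \<psi> where \<psi>: "preserves_cover T U \<psi>" "g = mor_by T U \<psi>"
    by (rule bc_hom_cases[OF U])
  from h obtain \<chi> where \<chi>: "preserves_cover U V \<chi>" "h = mor_by U V \<chi>"
    by (rule bc_hom_cases[OF V])
  have "(\<lambda>d. \<Union>c\<in>\<chi> d. \<Union>(\<phi> ` \<psi> c)) = (\<lambda>d. \<Union>(\<phi> ` \<Union>(\<psi> ` \<chi> d)))" by blast
  then show ?thesis
    by (simp add: \<phi>(2) \<psi>(2) \<chi>(2) mor_by_comp[OF S T U \<phi>(1) \<psi>(1)] mor_by_comp[OF T U V \<psi>(1) \<chi>(1)]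
        mor_by_comp[OF S U V preserves_cover_comp[OF T U \<phi>(1) \<psi>(1)] \<chi>(1)]
        mor_by_comp[OF S T V \<phi>(1) preserves_cover_comp[OF U V \<psi>(1) \<chi>(1)]])
qed

lemma bc_inv_eqI:
  assumes S: "basic_cover S" and T: "basic_cover T"
    and f: "f \<in> bc_hom S T" and g: "g \<in> bc_hom T S"
    and gf: "g \<cdot> f = bc_id S" and fg: "f \<cdot> g = bc_id T"
  shows "bc_inv f = g"
proof -
  have st: "src f = S" "trg f = T" using f by (auto simp: bc_hom_def mor_of_def)
  have "h = g" if h: "h \<in> bc_hom T S" "h \<cdot> f = bc_id S" for h
  proof -
    have "h = h \<cdot> (f \<cdot> g)" using bc_comp_id(1)[OF T S h(1)] fg by simp
    also have "\<dots> = (h \<cdot> f) \<cdot> g" by (rule bc_comp_assoc[OF T S T S g f h(1)])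
    also have "\<dots> = g" using bc_comp_id(2)[OF T S g] h(2) by simp
    finally show ?thesis .
  qed
  then show ?thesis unfolding bc_inv_def st by (intro the_equality conjI g gf fg) simp
qed


section \<open>The tensor product\<close>

lemma pts_tensor [simp]: "pts (S \<otimes> T) = pts S \<times> pts T"
  by (simp add: tensor_def generated_def)

lemma pts_unitE [simp]: "pts unitE = {()}"
  by (simp add: unitE_def generated_def)

lemma basic_cover_tensor: "basic_cover (S \<otimes> T)"
  by (simp add: tensor_def generated_basic_cover)

lemma basic_cover_unitE: "basic_cover unitE"
  by (simp add: unitE_def generated_basic_cover)

lemma cov_unitE: "cov unitE u U \<Longrightarrow> u \<in> U"
  by (auto simp: unitE_def generated_def elim: gen_cov.cases)

lemma generated_axiom:
  assumes "(a, W) \<in> X" "a \<in> S" "W \<subseteq> S"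
  shows "cov (generated S X) a W"
  using assms by (auto simp: generated_def intro: gen_cov.axiom gen_cov.elem)

lemma preserves_cover_generatedI:
  assumes S: "basic_cover S" and pts: "\<And>b. b \<in> P \<Longrightarrow> \<phi> b \<subseteq> pts S"
    and ax: "\<And>b W. (b, W) \<in> X \<Longrightarrow> b \<in> P \<Longrightarrow> covs S (\<phi> b) (\<Union>(\<phi> ` W))"
  shows "preserves_cover S (generated P X) \<phi>"
proof -
  have pts_UN: "\<Union>(\<phi> ` V) \<subseteq> pts S" if "V \<subseteq> P" for V
    using that by (intro UN_least pts) (rule subsetD)
  have "covs S (\<phi> b) (\<Union>(\<phi> ` V))" if "gen_cov P X b V" for b V
    using that
  proof (induction rule: gen_cov.induct)
    case (elem V b)
    then show ?case by (intro covs_subset[OF S] UN_upper pts_UN)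
  next
    case (axiom V b W)
    have "covs S (\<Union>(\<phi> ` W)) (\<Union>(\<phi> ` V))" using axiom by (intro covs_UN) blast
    moreover have "\<Union>(\<phi> ` V) \<subseteq> pts S" using axiom(1) by (rule pts_UN)
    ultimately show ?case using covs_trans[OF S ax] axiom(2,3) by simp
  qed
  then show ?thesis using pts by (simp add: preserves_cover_def generated_def)
qed

text \<open>
  Maps into a tensor product are the functions preserving covers in each argument, since these
  one-sided covers are the generating axioms.
\<close>

lemma preserves_cover_tensorI:
  assumes S: "basic_cover S" and T: "basic_cover T" and U: "basic_cover U"
    and pts: "\<And>b c. b \<in> pts T \<Longrightarrow> c \<in> pts U \<Longrightarrow> \<phi> (b, c) \<subseteq> pts S"
    and left: "\<And>b V c. cov T b V \<Longrightarrow> c \<in> pts U \<Longrightarrow> covs S (\<phi> (b, c)) (\<Union>v\<in>V. \<phi> (v, c))"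
    and right: "\<And>b c W. b \<in> pts T \<Longrightarrow> cov U c W \<Longrightarrow> covs S (\<phi> (b, c)) (\<Union>w\<in>W. \<phi> (b, w))"
  shows "preserves_cover S (T \<otimes> U) \<phi>"
  unfolding tensor_def
proof (rule preserves_cover_generatedI[OF S])
  fix p W
  assume "(p, W) \<in> tensor_axioms (pts T) {(a, U). cov T a U} (pts U) {(b, V). cov U b V}"
  then consider b V c where "p = (b, c)" "W = V \<times> {c}" "cov T b V" "c \<in> pts U"
    | b c V where "p = (b, c)" "W = {b} \<times> V" "b \<in> pts T" "cov U c V"
    unfolding tensor_axioms_def by blast
  then show "covs S (\<phi> p) (\<Union>(\<phi> ` W))"
  proof cases
    case 1
    moreover from 1 have "\<Union>(\<phi> ` W) = (\<Union>v\<in>V. \<phi> (v, c))" by blast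
    ultimately show ?thesis using left by simp
  next
    case 2
    moreover from 2 have "\<Union>(\<phi> ` W) = (\<Union>w\<in>V. \<phi> (b, w))" by blast
    ultimately show ?thesis using right by simp
  qed
qed (use pts in auto)

lemma cov_tensor_left:
  assumes S: "basic_cover S" and a: "cov S a U" "b \<in> pts T"
  shows "cov (S \<otimes> T) (a, b) (U \<times> {b})"
  unfolding tensor_def using a cov_pts[OF S a(1)]
  by (intro generated_axiom) (auto simp: tensor_axioms_def)

lemma cov_tensor_right:
  assumes T: "basic_cover T" and b: "a \<in> pts S" "cov T b V"
  shows "cov (S \<otimes> T) (a, b) ({a} \<times> V)"
  unfolding tensor_def using b cov_pts[OF T b(2)]
  by (intro generated_axiom) (auto simp: tensor_axioms_def)

lemma covs_tensor_left:
  "basic_cover S \<Longrightarrow> cov S a U \<Longrightarrow> b \<in> pts T \<Longrightarrow> covs (S \<otimes> T) {(a, b)} (\<Union>u\<in>U. {(u, b)})"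
  using cov_tensor_left[of S a U b T] unfolding covs_def Sigma_def by auto

lemma covs_tensor_right:
  "basic_cover T \<Longrightarrow> a \<in> pts S \<Longrightarrow> cov T b V \<Longrightarrow> covs (S \<otimes> T) {(a, b)} (\<Union>v\<in>V. {(a, v)})"
  using cov_tensor_right[of T a S b V] unfolding covs_def Sigma_def by auto

text \<open>
  A cover of both coordinates is obtained by moving one coordinate at a time, through
  \<open>U' \<times> V\<close>.
\<close>

lemma covs_tensor:
  assumes S: "basic_cover S" and T: "basic_cover T"
    and U: "covs S U U'" "U' \<subseteq> pts S" and V: "covs T V V'" "V' \<subseteq> pts T"
  shows "covs (S \<otimes> T) (U \<times> V) (U' \<times> V')"
proof -
  have "cov (S \<otimes> T) (a, b) (U' \<times> V')" if "a \<in> U" "b \<in> V" for a b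
  proof (rule basic_cover_trans[OF basic_cover_tensor])
    have b: "cov T b V'" using that V by (simp add: covs_def)
    show "U' \<times> V' \<subseteq> pts (S \<otimes> T)" using U V by auto
    show "cov (S \<otimes> T) (a, b) (U' \<times> {b})"
      using cov_tensor_left[OF S, where T = T] U that cov_pts[OF T b] by (simp add: covs_def)
    have "covs (S \<otimes> T) {(u, b)} (U' \<times> V')" if "u \<in> U'" for u
    proof (rule covs_trans[OF basic_cover_tensor])
      show "covs (S \<otimes> T) {(u, b)} ({u} \<times> V')" using cov_tensor_right[OF T _ b, where S = S] that U by (auto simp: covs_def)
      show "covs (S \<otimes> T) ({u} \<times> V') (U' \<times> V')"
        using that U V by (intro covs_subset basic_cover_tensor) auto
    qed (use U V in auto)
    then show "covs (S \<otimes> T) (U' \<times> {b}) (U' \<times> V')" by (auto simp: covs_def)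
  qed
  then show ?thesis by (auto simp: covs_def)
qed

lemma preserves_cover_tensor:
  assumes S: "basic_cover S" "basic_cover S'" and T: "basic_cover T" "basic_cover T'"
    and \<phi>: "preserves_cover S T \<phi>" and \<psi>: "preserves_cover S' T' \<psi>"
  shows "preserves_cover (S \<otimes> S') (T \<otimes> T') (\<lambda>(b, b'). \<phi> b \<times> \<psi> b')"
proof (rule preserves_cover_tensorI[OF basic_cover_tensor T]; unfold prod.case)
  fix b b' assume "b \<in> pts T" "b' \<in> pts T'"
  then show "\<phi> b \<times> \<psi> b' \<subseteq> pts (S \<otimes> S')"
    using preserves_cover_pts[OF \<phi>] preserves_cover_pts[OF \<psi>] by auto
next
  fix b V b' assume b: "cov T b V" "b' \<in> pts T'"
  have eq: "(\<Union>v\<in>V. \<phi> v \<times> \<psi> b') = \<Union>(\<phi> ` V) \<times> \<psi> b'" by blast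
  show "covs (S \<otimes> S') (\<phi> b \<times> \<psi> b') (\<Union>v\<in>V. \<phi> v \<times> \<psi> b')"
    unfolding eq using cov_pts[OF T(1) b(1)]
    by (intro covs_tensor S covs_subset preserves_cover_cov[OF \<phi> b(1)]
        preserves_cover_UN_pts[OF \<phi>] preserves_cover_pts[OF \<psi> b(2)] subset_refl) simp_all
next
  fix b b' V assume b: "b \<in> pts T" "cov T' b' V"
  have eq: "(\<Union>v\<in>V. \<phi> b \<times> \<psi> v) = \<phi> b \<times> \<Union>(\<psi> ` V)" by blast
  show "covs (S \<otimes> S') (\<phi> b \<times> \<psi> b') (\<Union>v\<in>V. \<phi> b \<times> \<psi> v)"
    unfolding eq using cov_pts[OF T(2) b(2)]
    by (intro covs_tensor S covs_subset preserves_cover_cov[OF \<psi> b(2)]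
        preserves_cover_UN_pts[OF \<psi>] preserves_cover_pts[OF \<phi> b(1)] subset_refl) simp_all
qed

lemma eqA_tensor:
  assumes S: "basic_cover S" and T: "basic_cover T"
    and "U \<subseteq> pts S" "U' \<subseteq> pts S" "eqA S U U'" "V \<subseteq> pts T" "V' \<subseteq> pts T" "eqA T V V'"
  shows "eqA (S \<otimes> T) (U \<times> V) (U' \<times> V')"
proof -
  have "U \<times> V \<subseteq> pts (S \<otimes> T)" "U' \<times> V' \<subseteq> pts (S \<otimes> T)" using assms by auto
  then show ?thesis using assms
    by (simp add: eqA_iff_covs basic_cover_tensor covs_tensor)
qed

lemma mor_by_tensor:
  assumes S: "basic_cover S" "basic_cover S'" and T: "basic_cover T" "basic_cover T'"
    and \<phi>: "preserves_cover S T \<phi>" and \<psi>: "preserves_cover S' T' \<psi>"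
  shows "mor_by S T \<phi> \<otimes>\<^sub>m mor_by S' T' \<psi> = mor_by (S \<otimes> S') (T \<otimes> T') (\<lambda>(b, b'). \<phi> b \<times> \<psi> b')"
proof -
  have *: "mor_by (S \<otimes> S') (T \<otimes> T') (\<lambda>(b, b'). (r\<inverse> `` {b}) \<times> (s\<inverse> `` {b'})) =
           mor_by (S \<otimes> S') (T \<otimes> T') (\<lambda>(b, b'). \<phi> b \<times> \<psi> b')"
    if r: "r \<in> rels (mor_by S T \<phi>)" and s: "s \<in> rels (mor_by S' T' \<psi>)" for r s
  proof (rule mor_by_cong)
    have r': "preserves_cover S T (\<lambda>b. r\<inverse> `` {b})" and s': "preserves_cover S' T' (\<lambda>c. s\<inverse> `` {c})"
      using r s by (simp_all add: in_rels_mor_by bc_map_iff_preserves_cover T)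
    fix p assume "p \<in> pts (T \<otimes> T')"
    then obtain b b' where p: "p = (b, b')" "b \<in> pts T" "b' \<in> pts T'" by auto
    have "eqA (S \<otimes> S') ((r\<inverse> `` {b}) \<times> (s\<inverse> `` {b'})) (\<phi> b \<times> \<psi> b')"
      using r s p
      by (intro eqA_tensor S preserves_cover_pts[OF r'] preserves_cover_pts[OF s']
          preserves_cover_pts[OF \<phi>] preserves_cover_pts[OF \<psi>]) (simp_all add: in_rels_mor_by)
    then show "eqA (S \<otimes> S') (case p of (b, b') \<Rightarrow> (r\<inverse> `` {b}) \<times> (s\<inverse> `` {b'}))
                (case p of (b, b') \<Rightarrow> \<phi> b \<times> \<psi> b')" by (simp add: p)
  qed
  have "rels (mor_by S T \<phi> \<otimes>\<^sub>m mor_by S' T' \<psi>) =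
        rels (mor_by (S \<otimes> S') (T \<otimes> T') (\<lambda>(b, b'). \<phi> b \<times> \<psi> b'))"
    using * rel_of_in_rels[OF T(1) \<phi>] rel_of_in_rels[OF T(2) \<psi>]
    by (simp add: tensor_mor_def) blast
  then show ?thesis by (simp add: tensor_mor_def mor_by_def)
qed

lemma tensor_mor_in_hom:
  assumes S: "basic_cover S" "basic_cover S'" and T: "basic_cover T" "basic_cover T'"
    and f: "f \<in> bc_hom S T" and g: "g \<in> bc_hom S' T'"
  shows "f \<otimes>\<^sub>m g \<in> bc_hom (S \<otimes> S') (T \<otimes> T')"
proof -
  from f obtain \<phi> where \<phi>: "preserves_cover S T \<phi>" "f = mor_by S T \<phi>"
    by (rule bc_hom_cases[OF T(1)])
  from g obtain \<psi> where \<psi>: "preserves_cover S' T' \<psi>" "g = mor_by S' T' \<psi>"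
    by (rule bc_hom_cases[OF T(2)])
  show ?thesis
    unfolding \<phi>(2) \<psi>(2) mor_by_tensor[OF S T \<phi>(1) \<psi>(1)]
    by (rule mor_by_in_bc_hom[OF basic_cover_tensor preserves_cover_tensor[OF S T \<phi>(1) \<psi>(1)]])
qed

lemma tensor_mor_comp:
  assumes S: "basic_cover S" and T: "basic_cover T" and U: "basic_cover U"
    and f: "f \<in> bc_hom S T" and g: "g \<in> bc_hom T U"
  shows "(g \<cdot> f) \<otimes>\<^sub>m (g \<cdot> f) = (g \<otimes>\<^sub>m g) \<cdot> (f \<otimes>\<^sub>m f)"
proof -
  from f obtain \<phi> where \<phi>: "preserves_cover S T \<phi>" "f = mor_by S T \<phi>"
    by (rule bc_hom_cases[OF T])
  from g obtain \<psi> where \<psi>: "preserves_cover T U \<psi>" "g = mor_by T U \<psi>"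
    by (rule bc_hom_cases[OF U])
  have \<phi>\<psi>: "preserves_cover S U (\<lambda>c. \<Union>(\<phi> ` \<psi> c))"
    by (rule preserves_cover_comp[OF T U \<phi>(1) \<psi>(1)])
  have "(\<lambda>(b, b'). \<Union>(\<phi> ` \<psi> b) \<times> \<Union>(\<phi> ` \<psi> b')) =
        (\<lambda>c. \<Union>((\<lambda>(b, b'). \<phi> b \<times> \<phi> b') ` (case c of (b, b') \<Rightarrow> \<psi> b \<times> \<psi> b')))"
    by (rule ext) (auto split: prod.splits; blast)
  then show ?thesis
    unfolding \<phi>(2) \<psi>(2) mor_by_comp[OF S T U \<phi>(1) \<psi>(1)] mor_by_tensor[OF S S U U \<phi>\<psi> \<phi>\<psi>]
      mor_by_tensor[OF S S T T \<phi>(1) \<phi>(1)] mor_by_tensor[OF T T U U \<psi>(1) \<psi>(1)]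
    by (subst mor_by_comp)
      (simp_all add: basic_cover_tensor preserves_cover_tensor S T U \<phi> \<psi>)
qed

lemma tensor_mor_id:
  assumes S: "basic_cover S"
  shows "bc_id S \<otimes>\<^sub>m bc_id S = bc_id (S \<otimes> S)"
proof -
  show ?thesis
    unfolding bc_id_eq mor_by_tensor[OF S S S S preserves_cover_id[OF S] preserves_cover_id[OF S]]
    by (rule mor_by_cong) (auto simp: eqA_refl)
qed

lemma preserves_cover_assoc:
  assumes S: "basic_cover S" and T: "basic_cover T" and U: "basic_cover U"
  shows "preserves_cover (S \<otimes> (T \<otimes> U)) ((S \<otimes> T) \<otimes> U) (\<lambda>((a, b), c). {(a, (b, c))})"
    (is "preserves_cover _ _ ?\<alpha>")
proof (rule preserves_cover_tensorI[OF basic_cover_tensor basic_cover_tensor U])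
  \<comment> \<open>Covers in the first argument are themselves covers in a tensor product, so with \<open>c\<close> held fixed
    the criterion for maps into a tensor product applies once more.\<close>
  fix p W c assume p: "cov (S \<otimes> T) p W" and c: "c \<in> pts U"
  have "preserves_cover (S \<otimes> (T \<otimes> U)) (S \<otimes> T) (\<lambda>(a, b). {(a, (b, c))})"
  proof (rule preserves_cover_tensorI[OF basic_cover_tensor S T]; unfold prod.case)
    fix a V b assume "cov S a V" "b \<in> pts T"
    then show "covs (S \<otimes> (T \<otimes> U)) {(a, (b, c))} (\<Union>v\<in>V. {(v, (b, c))})"
      using c by (intro covs_tensor_left S) simp_all
  next
    fix a V b assume ab: "a \<in> pts S" "cov T b V"
    have "covs (S \<otimes> (T \<otimes> U)) {(a, (b, c))} (\<Union>p\<in>V \<times> {c}. {(a, p)})"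
      by (intro covs_tensor_right basic_cover_tensor cov_tensor_left T ab c)
    moreover have "(\<Union>p\<in>V \<times> {c}. {(a, p)}) = (\<Union>v\<in>V. {(a, (v, c))})" by blast
    ultimately show "covs (S \<otimes> (T \<otimes> U)) {(a, (b, c))} (\<Union>v\<in>V. {(a, (v, c))})" by metis
  qed (use c in auto)
  from preserves_cover_cov[OF this p]
  show "covs (S \<otimes> (T \<otimes> U)) (?\<alpha> (p, c))
          (\<Union>v\<in>W. ?\<alpha> (v, c))"
    by (simp add: case_prod_unfold)
next
  fix p c V assume p: "p \<in> pts (S \<otimes> T)" and c: "cov U c V"
  obtain a b where ab: "p = (a, b)" "a \<in> pts S" "b \<in> pts T" using p by auto
  have "covs (S \<otimes> (T \<otimes> U)) {(a, (b, c))} (\<Union>p\<in>{b} \<times> V. {(a, p)})"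
    by (intro covs_tensor_right basic_cover_tensor cov_tensor_right U ab c)
  moreover have "(\<Union>p\<in>{b} \<times> V. {(a, p)}) = (\<Union>v\<in>V. {(a, (b, v))})" by blast
  ultimately show "covs (S \<otimes> (T \<otimes> U)) (?\<alpha> (p, c))
          (\<Union>v\<in>V. ?\<alpha> (p, v))"
    unfolding ab(1) prod.case by metis
qed auto

lemma preserves_cover_swap:
  assumes S: "basic_cover S" and T: "basic_cover T"
  shows "preserves_cover (S \<otimes> T) (T \<otimes> S) (\<lambda>(b, a). {(a, b)})"
  by (rule preserves_cover_tensorI[OF basic_cover_tensor T S])
    (simp_all only: prod.case covs_tensor_left[OF S] covs_tensor_right[OF T], simp)

text \<open>
  The unit object has no axioms, so its cover is membership and a map to it is just a subset.
\<close>

lemma preserves_cover_to_unitE: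
  assumes "basic_cover S"
  shows "preserves_cover S unitE e \<longleftrightarrow> e () \<subseteq> pts S"
proof
  assume "e () \<subseteq> pts S"
  then show "preserves_cover S unitE e"
    using assms cov_unitE by (auto simp: preserves_cover_def intro!: covs_subset)
qed (simp add: preserves_cover_def)

lemma bc_inv_lunit:
  assumes S: "basic_cover S"
  shows "bc_inv (lunit_mor S) = mor_by S (unitE \<otimes> S) (\<lambda>(_, a). {a})"
proof -
  have l: "preserves_cover (unitE \<otimes> S) S (\<lambda>a. {((), a)})"
    using covs_tensor_right[OF S, of "()" unitE] unfolding preserves_cover_def by auto
  have l': "preserves_cover S (unitE \<otimes> S) (\<lambda>(_, a). {a})"
    by (rule preserves_cover_tensorI[OF S basic_cover_unitE S])
      (auto simp: covs_def S dest!: cov_unitE intro: basic_cover_refl)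
  note E = basic_cover_tensor[of unitE S]
  have eq: "(\<lambda>p. \<Union>((\<lambda>a. {((), a)}) ` (case p of (_, a) \<Rightarrow> {a}))) = (\<lambda>p. {p})"
    by (auto split: prod.splits)
  show ?thesis unfolding lunit_mor_def
    by (rule bc_inv_eqI[OF E S])
      (simp_all add: mor_by_in_bc_hom E S l l' mor_by_comp[OF S E S] mor_by_comp[OF E S E] bc_id_eq eq)
qed

lemma bc_inv_runit:
  assumes S: "basic_cover S"
  shows "bc_inv (runit_mor S) = mor_by S (S \<otimes> unitE) (\<lambda>(a, _). {a})"
proof -
  have l: "preserves_cover (S \<otimes> unitE) S (\<lambda>a. {(a, ())})"
    using covs_tensor_left[OF S, of _ _ "()" unitE] unfolding preserves_cover_def by auto
  have l': "preserves_cover S (S \<otimes> unitE) (\<lambda>(a, _). {a})"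
    by (rule preserves_cover_tensorI[OF S S basic_cover_unitE])
      (auto simp: covs_def S dest!: cov_unitE intro: basic_cover_refl)
  note E = basic_cover_tensor[of S unitE]
  have eq: "(\<lambda>p. \<Union>((\<lambda>a. {(a, ())}) ` (case p of (a, _) \<Rightarrow> {a}))) = (\<lambda>p. {p})"
    by (auto split: prod.splits)
  show ?thesis unfolding runit_mor_def
    by (rule bc_inv_eqI[OF E S])
      (simp_all add: mor_by_in_bc_hom E S l l' mor_by_comp[OF S E S] mor_by_comp[OF E S E] bc_id_eq eq)
qed

section \<open>Commutative comonoids in terms of points\<close>

text \<open>
  The extension by unions of a set-valued product of points; it is also the inverse image of
  \<open>U \<times> V\<close> under the comultiplication with point inverse images \<open>m\<close>.
\<close>

definition lift_op :: "('a \<times> 'a \<Rightarrow> 'a set) \<Rightarrow> 'a set \<Rightarrow> 'a set \<Rightarrow> 'a set" where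
  "lift_op m U V = \<Union>(m ` (U \<times> V))"

definition comonoid_laws :: "'a bcover \<Rightarrow> ('a \<times> 'a \<Rightarrow> 'a set) \<Rightarrow> 'a set \<Rightarrow> bool" where
  "comonoid_laws S m I \<longleftrightarrow>
     (\<forall>a\<in>pts S. \<forall>b\<in>pts S. \<forall>c\<in>pts S.
        eqA S (lift_op m {a} (m (b, c))) (lift_op m (m (a, b)) {c})) \<and>
     (\<forall>a\<in>pts S. \<forall>b\<in>pts S. eqA S (m (a, b)) (m (b, a))) \<and>
     (\<forall>a\<in>pts S. eqA S (lift_op m I {a}) {a} \<and> eqA S (lift_op m {a} I) {a})"

lemma lift_op_mono: "U \<subseteq> U' \<Longrightarrow> V \<subseteq> V' \<Longrightarrow> lift_op m U V \<subseteq> lift_op m U' V'"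
  unfolding lift_op_def by blast

lemma lift_op_singletons: "lift_op m {a} {b} = m (a, b)"
  by (simp add: lift_op_def)

lemma lift_op_pts:
  "preserves_cover S (S \<otimes> S) m \<Longrightarrow> U \<subseteq> pts S \<Longrightarrow> V \<subseteq> pts S \<Longrightarrow> lift_op m U V \<subseteq> pts S"
  unfolding lift_op_def by (rule preserves_cover_UN_pts) auto

lemma lift_op_covs:
  assumes S: "basic_cover S" and m: "preserves_cover S (S \<otimes> S) m"
    and "covs S U U'" "U' \<subseteq> pts S" "covs S V V'" "V' \<subseteq> pts S"
  shows "covs S (lift_op m U V) (lift_op m U' V')"
  unfolding lift_op_def using assms by (intro preserves_cover_covs[OF m] covs_tensor)

lemma lift_op_eqA:
  assumes S: "basic_cover S" and m: "preserves_cover S (S \<otimes> S) m"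
    and U: "U \<subseteq> pts S" "U' \<subseteq> pts S" "eqA S U U'" and V: "V \<subseteq> pts S" "V' \<subseteq> pts S" "eqA S V V'"
  shows "eqA S (lift_op m U V) (lift_op m U' V')"
  using U V lift_op_pts[OF m] by (simp add: eqA_iff_covs[OF S] lift_op_covs[OF S m])

lemma ind_generated_basic_cover: "ind_generated S \<Longrightarrow> basic_cover S"
  unfolding ind_generated_def using generated_basic_cover by metis

text \<open>
  Each side of each comonoid diagram is the morphism of an explicit function. Two morphisms agree when
  these functions agree up to \<^const>\<open>eqA\<close>, and the resulting equations are the laws.
\<close>

lemma comm_comonoid_iff_laws:
  assumes S: "ind_generated S" and m: "preserves_cover S (S \<otimes> S) m" and e: "preserves_cover S unitE e"
  shows "comm_comonoid \<lparr>obj = S, mult = mor_by S (S \<otimes> S) m, counit = mor_by S unitE e\<rparr> \<longleftrightarrow>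
    comonoid_laws S m (e ())"
proof -
  note B = ind_generated_basic_cover[OF S]
  note BB = basic_cover_tensor[of S S] and BE = basic_cover_unitE
  note i = preserves_cover_id[OF B]
  note im = preserves_cover_tensor[OF B B B BB i m] and mi = preserves_cover_tensor[OF B B BB B m i]
  note ei = preserves_cover_tensor[OF B B BE B e i] and ie = preserves_cover_tensor[OF B B B BE i e]
  let ?\<mu> = "mor_by S (S \<otimes> S) m" and ?\<eta> = "mor_by S unitE e"
  have 1: "assoc_mor S S S \<cdot> (bc_id S \<otimes>\<^sub>m ?\<mu>) \<cdot> ?\<mu> =
      mor_by S ((S \<otimes> S) \<otimes> S) (\<lambda>((a, b), c). lift_op m {a} (m (b, c)))"
    unfolding bc_id_eq mor_by_tensor[OF B B B BB i m] mor_by_comp[OF B BB basic_cover_tensor m im]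
      assoc_mor_def
      mor_by_comp[OF B basic_cover_tensor basic_cover_tensor
        preserves_cover_comp[OF BB basic_cover_tensor m im] preserves_cover_assoc[OF B B B]]
    by (rule mor_by_cong) (auto simp: eqA_refl lift_op_def)
  have 2: "(?\<mu> \<otimes>\<^sub>m bc_id S) \<cdot> ?\<mu> = mor_by S ((S \<otimes> S) \<otimes> S) (\<lambda>((a, b), c). lift_op m (m (a, b)) {c})"
    unfolding bc_id_eq mor_by_tensor[OF B B BB B m i] mor_by_comp[OF B BB basic_cover_tensor m mi]
    by (rule mor_by_cong) (auto simp: eqA_refl lift_op_def)
  have 3: "swap_mor S S \<cdot> ?\<mu> = mor_by S (S \<otimes> S) (\<lambda>(b, a). m (a, b))"
    unfolding swap_mor_def mor_by_comp[OF B BB BB m preserves_cover_swap[OF B B]]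
    by (rule mor_by_cong) (auto simp: eqA_refl)
  have 4: "(?\<eta> \<otimes>\<^sub>m bc_id S) \<cdot> ?\<mu> = mor_by S (unitE \<otimes> S) (\<lambda>(u, a). lift_op m (e u) {a})"
    unfolding bc_id_eq mor_by_tensor[OF B B BE B e i] mor_by_comp[OF B BB basic_cover_tensor m ei]
    by (rule mor_by_cong) (auto simp: eqA_refl lift_op_def)
  have 5: "(bc_id S \<otimes>\<^sub>m ?\<eta>) \<cdot> ?\<mu> = mor_by S (S \<otimes> unitE) (\<lambda>(a, u). lift_op m {a} (e u))"
    unfolding bc_id_eq mor_by_tensor[OF B B B BE i e] mor_by_comp[OF B BB basic_cover_tensor m ie]
    by (rule mor_by_cong) (auto simp: eqA_refl lift_op_def)
  have p1: "preserves_cover S ((S \<otimes> S) \<otimes> S) (\<lambda>((a, b), c). lift_op m {a} (m (b, c)))"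
    using preserves_cover_comp[OF basic_cover_tensor basic_cover_tensor
        preserves_cover_comp[OF BB basic_cover_tensor m im] preserves_cover_assoc[OF B B B]]
    by (simp add: lift_op_def case_prod_unfold)
  have p3: "preserves_cover S (S \<otimes> S) (\<lambda>(b, a). m (a, b))"
    using preserves_cover_comp[OF BB BB m preserves_cover_swap[OF B B]]
    by (simp add: case_prod_unfold)
  have p4: "preserves_cover S (unitE \<otimes> S) (\<lambda>(u, a). lift_op m (e u) {a})"
    using preserves_cover_comp[OF BB basic_cover_tensor m ei]
    by (simp add: lift_op_def case_prod_unfold)
  have p5: "preserves_cover S (S \<otimes> unitE) (\<lambda>(a, u). lift_op m {a} (e u))"
    using preserves_cover_comp[OF BB basic_cover_tensor m ie]
    by (simp add: lift_op_def case_prod_unfold)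
  show ?thesis
    unfolding comm_comonoid_def Let_def comon.simps 1 2 3 4 5 bc_inv_lunit[OF B] bc_inv_runit[OF B]
      mor_by_eq_iff[OF basic_cover_tensor p1] mor_by_eq_iff[OF basic_cover_tensor p3]
      mor_by_eq_iff[OF basic_cover_tensor p4] mor_by_eq_iff[OF basic_cover_tensor p5]
    using S mor_by_in_bc_hom[OF BB m] mor_by_in_bc_hom[OF BE e]
    by (auto simp: comonoid_laws_def)
qed

text \<open>
  A canonical choice of a function representing a morphism: the union over all representatives is
  attained by the saturated one, by \<open>preimage_mor_by\<close>.
\<close>

definition preimage :: "('a, 'b) mor \<Rightarrow> 'b \<Rightarrow> 'a set" where
  "preimage f b = (\<Union>r\<in>rels f. r\<inverse> `` {b})"

text \<open>
  Every representative lies below the saturation of \<open>\<phi>\<close>, which is itself a representative.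
\<close>

lemma preimage_mor_by:
  assumes S: "basic_cover S" and T: "basic_cover T" and \<phi>: "preserves_cover S T \<phi>" and b: "b \<in> pts T"
  shows "preimage (mor_by S T \<phi>) b = sat S (\<phi> b)"
proof
  have "r\<inverse> `` {b} \<subseteq> sat S (\<phi> b)" if "r \<in> rels (mor_by S T \<phi>)" for r
  proof -
    have r: "bc_map S T r" "sat S (r\<inverse> `` {b}) = sat S (\<phi> b)"
      using that b by (simp_all add: in_rels_mor_by eqA_def)
    then have "r\<inverse> `` {b} \<subseteq> pts S" by (auto simp: bc_map_def)
    then show ?thesis using sat_increasing[OF S] r(2) by metis
  qed
  then show "preimage (mor_by S T \<phi>) b \<subseteq> sat S (\<phi> b)" by (auto simp: preimage_def)
next
  have eq: "mor_by S T (\<lambda>b. sat S (\<phi> b)) = mor_by S T \<phi>"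
    using preserves_cover_pts[OF \<phi>] by (intro mor_by_cong eqA_sat[OF S])
  have "preserves_cover S T (\<lambda>b. sat S (\<phi> b))"
    using preserves_cover_pts[OF \<phi>] by (intro preserves_cover_cong[OF S T \<phi>] sat_subset eqA_sat[OF S])
  from rel_of_in_rels[OF T this] show "sat S (\<phi> b) \<subseteq> preimage (mor_by S T \<phi>) b"
    unfolding eq preimage_def using rel_of_preimage[OF b, of "\<lambda>b. sat S (\<phi> b)"] by blast
qed

lemma bc_hom_preimage:
  assumes S: "basic_cover S" and T: "basic_cover T" and f: "f \<in> bc_hom S T"
  shows "preserves_cover S T (preimage f)" "mor_by S T (preimage f) = f"
proof -
  from f obtain \<phi> where \<phi>: "preserves_cover S T \<phi>" "f = mor_by S T \<phi>"
    by (rule bc_hom_cases[OF T])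
  have e: "eqA S (preimage f b) (\<phi> b)" and P: "preimage f b \<subseteq> pts S" if "b \<in> pts T" for b
    using that preserves_cover_pts[OF \<phi>(1)]
    by (simp_all add: \<phi>(2) preimage_mor_by[OF S T \<phi>(1)] eqA_sat[OF S] sat_subset)
  show "mor_by S T (preimage f) = f"
    unfolding \<phi>(2) by (rule mor_by_cong) (use e \<phi>(2) in simp)
  show "preserves_cover S T (preimage f)"
    by (rule preserves_cover_cong[OF S T \<phi>(1) P e])
qed


section \<open>Convergent covers from comonoid laws and back\<close>

lemma generated_eqI:
  assumes XY: "X \<subseteq> Y" and Y: "\<And>a W. (a, W) \<in> Y \<Longrightarrow> cov (generated P X) a W"
  shows "generated P X = generated P Y"
proof -
  have "gen_cov P X a W \<longleftrightarrow> gen_cov P Y a W" for a W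
  proof
    show "gen_cov P X a W" if "gen_cov P Y a W"
      using that by (rule gen_cov_mono_axioms) (use Y in \<open>simp add: generated_def\<close>)
    have "gen_cov P Y a W" if "(a, W) \<in> X" for a W
      using generated_axiom[of a W Y P] that XY cov_pts[OF generated_basic_cover Y, of a W]
      by (auto simp: generated_def)
    then show "gen_cov P Y a W" if "gen_cov P X a W"
      using that gen_cov_mono_axioms by metis
  qed
  then show ?thesis by (simp add: generated_def fun_eq_iff)
qed

text \<open>
  Any set of axioms within \<open>P\<close> can be indexed by the covering sets themselves.
\<close>

lemma ind_generatedI:
  assumes "\<And>a W. (a, W) \<in> X \<Longrightarrow> a \<in> P \<and> W \<subseteq> P"
  shows "ind_generated (generated P X)"
proof -
  have "axioms_of P (\<lambda>a. {W. (a, W) \<in> X}) (\<lambda>a W. W) = X"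
    using assms by (auto simp: axioms_of_def)
  moreover have "axiom_set P (\<lambda>a. {W. (a, W) \<in> X}) (\<lambda>a W. W)"
    using assms by (auto simp: axiom_set_def)
  ultimately show ?thesis
    unfolding ind_generated_def by (intro exI conjI) (auto simp: generated_def)
qed

context
  fixes S :: "'a bcover" and m I and K :: "'a ccover"
  assumes gen: "ind_generated S" and m: "preserves_cover S (S \<otimes> S) m"
    and laws: "comonoid_laws S m I" and I: "I \<subseteq> pts S"
    and base: "base K = S"
    and circ: "circ K = (\<lambda>U\<in>Pow (pts S). \<lambda>V\<in>Pow (pts S). lift_op m U V)"
begin

private lemma S: "basic_cover S"
  using gen by (rule ind_generated_basic_cover)

private lemma circ_eq: "U \<subseteq> pts S \<Longrightarrow> V \<subseteq> pts S \<Longrightarrow> circ K U V = lift_op m U V"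
  by (simp add: circ)

private lemma lift_op_assoc:
  assumes U: "U \<subseteq> pts S" "V \<subseteq> pts S" "W \<subseteq> pts S"
  shows "covs S (lift_op m (lift_op m U V) W) (lift_op m U (lift_op m V W))"
proof -
  have R: "lift_op m U (lift_op m V W) \<subseteq> pts S" using U by (intro lift_op_pts[OF m])
  have "cov S x (lift_op m U (lift_op m V W))" if x: "x \<in> lift_op m (lift_op m U V) W" for x
  proof -
    obtain a b c where abc: "a \<in> U" "b \<in> V" "c \<in> W" "x \<in> lift_op m (m (a, b)) {c}"
      using x unfolding lift_op_def by fastforce
    then have s: "a \<in> pts S" "b \<in> pts S" "c \<in> pts S" using U by auto
    have P: "lift_op m {a} (m (b, c)) \<subseteq> pts S" "lift_op m (m (a, b)) {c} \<subseteq> pts S"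
      using s preserves_cover_pts[OF m] by (simp_all add: lift_op_pts[OF m])
    have "eqA S (lift_op m {a} (m (b, c))) (lift_op m (m (a, b)) {c})"
      using laws s by (simp add: comonoid_laws_def)
    then have "covs S (lift_op m (m (a, b)) {c}) (lift_op m {a} (m (b, c)))"
      by (simp add: eqA_iff_covs[OF S P])
    moreover have "lift_op m {a} (m (b, c)) \<subseteq> lift_op m U (lift_op m V W)"
      using abc by (intro lift_op_mono) (auto simp: lift_op_def)
    ultimately have "covs S (lift_op m (m (a, b)) {c}) (lift_op m U (lift_op m V W))"
      using covs_trans[OF S _ covs_subset[OF S _ R] R] by simp
    then show ?thesis using abc by (simp add: covs_def)
  qed
  then show ?thesis by (simp add: covs_def)
qed

private lemma lift_op_comm:
  assumes U: "U \<subseteq> pts S" "V \<subseteq> pts S"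
  shows "covs S (lift_op m U V) (lift_op m V U)"
proof -
  have "eqA S (m p) (m (snd p, fst p))" if "p \<in> U \<times> V" for p
  proof -
    have "fst p \<in> pts S" "snd p \<in> pts S" using that U by auto
    then show ?thesis using laws unfolding comonoid_laws_def by (metis prod.collapse)
  qed
  moreover have "m p \<subseteq> pts S" "m (snd p, fst p) \<subseteq> pts S" if "p \<in> U \<times> V" for p
    using that U by (intro preserves_cover_pts[OF m]; auto)+
  ultimately have "eqA S (\<Union>p\<in>U \<times> V. m p) (\<Union>p\<in>U \<times> V. m (snd p, fst p))"
    by (intro eqA_UN[OF S]) (simp_all add: mem_Times_iff)
  moreover have "(\<Union>p\<in>U \<times> V. m (snd p, fst p)) = lift_op m V U"
    by (force simp: lift_op_def)
  ultimately have "eqA S (lift_op m U V) (lift_op m V U)" by (simp add: lift_op_def)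
  then show ?thesis using eqA_iff_covs[OF S lift_op_pts[OF m U] lift_op_pts[OF m U(2,1)]] by simp
qed

text \<open>
  On subsets the operation preserves unions strictly, and saturating an argument or a member of a
  union changes the result only up to \<^const>\<open>eqA\<close>.
\<close>

private lemma lift_op_Sup:
  assumes \<U>: "\<U> \<subseteq> Sat S" and V: "V \<in> Sat S"
  shows "Sat_circ K (Sat_join S \<U>) V = Sat_join S ((\<lambda>U. Sat_circ K U V) ` \<U>)"
    and "Sat_circ K V (Sat_join S \<U>) = Sat_join S ((\<lambda>U. Sat_circ K V U) ` \<U>)"
proof -
  have P: "U \<subseteq> pts S" if "U \<in> \<U>" for U using \<U> that by (auto simp: Sat_def)
  then have PU: "\<Union>\<U> \<subseteq> pts S" by blast
  have PV: "V \<subseteq> pts S" using V by (auto simp: Sat_def)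
  note s = sat_subset[of S "\<Union>\<U>"]
  have "eqA S (lift_op m (sat S (\<Union>\<U>)) V) (lift_op m (\<Union>\<U>) V)"
    by (intro lift_op_eqA[OF S m] s PU PV eqA_sat[OF S] eqA_refl)
  moreover have "lift_op m (\<Union>\<U>) V = (\<Union>U\<in>\<U>. lift_op m U V)" by (auto simp: lift_op_def)
  moreover have "eqA S (\<Union>U\<in>\<U>. sat S (lift_op m U V)) (\<Union>U\<in>\<U>. lift_op m U V)"
    by (intro eqA_UN[OF S] eqA_sat[OF S] sat_subset lift_op_pts[OF m] P PV)
  ultimately show "Sat_circ K (Sat_join S \<U>) V = Sat_join S ((\<lambda>U. Sat_circ K U V) ` \<U>)"
    using P PV s by (simp add: Sat_circ_def base Sat_join_def circ_eq eqA_def)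
  have "eqA S (lift_op m V (sat S (\<Union>\<U>))) (lift_op m V (\<Union>\<U>))"
    by (intro lift_op_eqA[OF S m] s PU PV eqA_sat[OF S] eqA_refl)
  moreover have "lift_op m V (\<Union>\<U>) = (\<Union>U\<in>\<U>. lift_op m V U)" by (auto simp: lift_op_def)
  moreover have "eqA S (\<Union>U\<in>\<U>. sat S (lift_op m V U)) (\<Union>U\<in>\<U>. lift_op m V U)"
    by (intro eqA_UN[OF S] eqA_sat[OF S] sat_subset lift_op_pts[OF m] P PV)
  ultimately show "Sat_circ K V (Sat_join S \<U>) = Sat_join S ((\<lambda>U. Sat_circ K V U) ` \<U>)"
    using P PV s by (simp add: Sat_circ_def base Sat_join_def circ_eq eqA_def)
qed

private lemma convergent: "convergent_cover K"
  unfolding convergent_cover_def Let_def base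
proof (intro conjI ballI allI impI S; (elim conjE)?; (unfold Pow_iff)?)
  show "circ K \<in> Pow (pts S) \<rightarrow>\<^sub>E Pow (pts S) \<rightarrow>\<^sub>E Pow (pts S)"
    unfolding circ by (simp add: restrict_PiE_iff lift_op_pts[OF m])
next
  fix U U' V V' assume "U \<subseteq> pts S" "U' \<subseteq> pts S" "V \<subseteq> pts S" "V' \<subseteq> pts S" "covs S U U'" "covs S V V'"
  then show "covs S (circ K U V) (circ K U' V')" by (simp add: circ_eq lift_op_covs[OF S m])
next
  fix U V W assume "U \<subseteq> pts S" "V \<subseteq> pts S" "W \<subseteq> pts S"
  then show "covs S (circ K (circ K U V) W) (circ K U (circ K V W))"
    by (simp add: circ_eq lift_op_pts[OF m] lift_op_assoc)
next
  fix U V assume "U \<subseteq> pts S" "V \<subseteq> pts S"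
  then show "covs S (circ K U V) (circ K V U)" by (simp add: circ_eq lift_op_comm)
qed (rule lift_op_Sup; assumption)+

lemma is_unit_of_laws: "is_unit K I"
  using laws I unfolding is_unit_def base by (simp add: circ_eq comonoid_laws_def)

text \<open>
  The axioms generating \<open>S\<close>, together with \<open>m\<close>, also generate \<open>K\<close>: the commutativity and associativity
  axioms hold by the laws, and the localised axioms hold because the operation is compatible with
  the cover.
\<close>

lemma ind_generated_cc_of_laws: "ind_generated_cc K"
proof -
  obtain J :: "'a \<Rightarrow> 'a set set" and C where J: "axiom_set (pts S) J C"
    and SX: "S = generated (pts S) (axioms_of (pts S) J C)"
    using gen by (auto simp: ind_generated_def)
  let ?X = "axioms_of (pts S) J C"
  let ?Y = "comm_assoc_axioms (pts S) (circ K) ?X"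
  have X: "cov S a W" if "(a, W) \<in> ?X" for a W
    using generated_axiom[OF that, of "pts S"] that J SX
    by (auto simp: axioms_of_def axiom_set_def)
  have Y: "cov S a W" if "(a, W) \<in> ?Y" for a W
  proof -
    from that consider "(a, W) \<in> ?X"
      | b c where "W = circ K {c} {b}" "b \<in> pts S" "c \<in> pts S" "a \<in> circ K {b} {c}"
      | b c d where "W = circ K {b} (circ K {c} {d})" "b \<in> pts S" "c \<in> pts S" "d \<in> pts S"
          "a \<in> circ K (circ K {b} {c}) {d}"
      unfolding comm_assoc_axioms_def by blast
    then show ?thesis
    proof cases
      case 1 then show ?thesis by (rule X)
    next
      case 2 then show ?thesis
        using lift_op_comm[of "{b}" "{c}"] by (simp add: circ_eq covs_def)
    next
      case 3 then show ?thesis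
        using lift_op_assoc[of "{b}" "{c}" "{d}"] by (simp add: circ_eq lift_op_pts[OF m] covs_def)
    qed
  qed
  have Z: "cov S a W" if "(a, W) \<in> local_axioms (pts S) (circ K) ?Y" for a W
  proof -
    from that consider "(a, W) \<in> ?Y"
      | b c V where "W = circ K V {c}" "(b, V) \<in> ?Y" "c \<in> pts S" "a \<in> circ K {b} {c}"
      unfolding local_axioms_def by blast
    then show ?thesis
    proof cases
      case 1 then show ?thesis by (rule Y)
    next
      case 2
      then have b: "cov S b V" by (simp add: Y)
      have "covs S (lift_op m {b} {c}) (lift_op m V {c})"
        using b cov_pts[OF S b] 2(3)
        by (intro lift_op_covs[OF S m]) (auto simp: covs_def intro: basic_cover_refl[OF S])
      then show ?thesis using 2 cov_pts[OF S b] by (simp add: circ_eq covs_def)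
    qed
  qed
  have "?X \<subseteq> local_axioms (pts S) (circ K) ?Y"
    by (auto simp: local_axioms_def comm_assoc_axioms_def)
  then have "generated (pts S) ?X = generated (pts S) (local_axioms (pts S) (circ K) ?Y)"
    by (rule generated_eqI) (use Z SX in simp)
  then have "S = generated (pts S) (local_axioms (pts S) (circ K) ?Y)" using SX by simp
  moreover have "\<forall>U V. U \<subseteq> pts S \<and> V \<subseteq> pts S \<longrightarrow> circ K U V = (\<Union>a\<in>U. \<Union>b\<in>V. m (a, b))"
    by (auto simp: circ_eq lift_op_def)
  moreover have "\<forall>a\<in>pts S. \<forall>b\<in>pts S. m (a, b) \<subseteq> pts S" using preserves_cover_pts[OF m] by simp
  ultimately show ?thesis
    unfolding ind_generated_cc_def Let_def base
    by (intro conjI convergent exI[of _ J] exI[of _ C] exI[of _ "\<lambda>a b. m (a, b)"] J)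
qed

end

text \<open>
  Conversely, the point products \<open>{a} \<circ> {b}\<close> of an inductively generated convergent cover determine its
  operation and satisfy the laws.
\<close>

context
  fixes K :: "'a ccover"
  assumes K: "ind_generated_cc K"
begin

private abbreviation (input) "S \<equiv> base K"
private abbreviation (input) "m \<equiv> \<lambda>(a, b). circ K {a} {b}"

lemma ind_generated_cc_convergent: "convergent_cover K"
  using K by (simp add: ind_generated_cc_def)

lemma ind_generated_cc_basic_cover: "basic_cover (base K)"
  using ind_generated_cc_convergent by (simp add: convergent_cover_def Let_def)

lemma circ_pts: "U \<subseteq> pts S \<Longrightarrow> V \<subseteq> pts S \<Longrightarrow> circ K U V \<subseteq> pts S"
proof -
  assume UV: "U \<subseteq> pts S" "V \<subseteq> pts S"
  have "circ K \<in> Pow (pts S) \<rightarrow>\<^sub>E Pow (pts S) \<rightarrow>\<^sub>E Pow (pts S)"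
    using ind_generated_cc_convergent by (simp add: convergent_cover_def Let_def)
  from PiE_mem[OF PiE_mem[OF this, of U], of V] UV show ?thesis by simp
qed

lemma circ_covs:
  "U \<subseteq> pts S \<Longrightarrow> U' \<subseteq> pts S \<Longrightarrow> V \<subseteq> pts S \<Longrightarrow> V' \<subseteq> pts S \<Longrightarrow>
    covs S U U' \<Longrightarrow> covs S V V' \<Longrightarrow> covs S (circ K U V) (circ K U' V')"
  using ind_generated_cc_convergent unfolding convergent_cover_def Let_def by simp

lemma circ_assoc_covs:
  "U \<subseteq> pts S \<Longrightarrow> V \<subseteq> pts S \<Longrightarrow> W \<subseteq> pts S \<Longrightarrow> covs S (circ K (circ K U V) W) (circ K U (circ K V W))"
  using ind_generated_cc_convergent unfolding convergent_cover_def Let_def by simp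

lemma circ_comm_covs: "U \<subseteq> pts S \<Longrightarrow> V \<subseteq> pts S \<Longrightarrow> covs S (circ K U V) (circ K V U)"
  using ind_generated_cc_convergent unfolding convergent_cover_def Let_def by simp

lemma circ_eq_lift_op: "U \<subseteq> pts S \<Longrightarrow> V \<subseteq> pts S \<Longrightarrow> circ K U V = lift_op m U V"
proof -
  assume UV: "U \<subseteq> pts S" "V \<subseteq> pts S"
  obtain \<delta> where \<delta>: "U \<subseteq> pts S \<and> V \<subseteq> pts S \<longrightarrow> circ K U V = (\<Union>a\<in>U. \<Union>b\<in>V. \<delta> a b)" for U V
    using K unfolding ind_generated_cc_def Let_def by metis
  have "circ K {a} {b} = \<delta> a b" if "a \<in> U" "b \<in> V" for a b
    using \<delta>[of "{a}" "{b}"] UV that by auto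
  then have "(\<Union>a\<in>U. \<Union>b\<in>V. circ K {a} {b}) = (\<Union>a\<in>U. \<Union>b\<in>V. \<delta> a b)" by simp
  moreover have "lift_op m U V = (\<Union>a\<in>U. \<Union>b\<in>V. circ K {a} {b})" by (auto simp: lift_op_def)
  ultimately show ?thesis using \<delta>[of U V] UV by simp
qed

lemma ind_generated_base: "ind_generated S"
proof -
  obtain J :: "'a \<Rightarrow> 'a set set" and C where J: "axiom_set (pts S) J C" and
    S: "S = generated (pts S)
      (local_axioms (pts S) (circ K) (comm_assoc_axioms (pts S) (circ K) (axioms_of (pts S) J C)))"
    using K unfolding ind_generated_cc_def Let_def by metis
  have X: "a \<in> pts S \<and> W \<subseteq> pts S" if "(a, W) \<in> axioms_of (pts S) J C" for a W
    using that J by (auto simp: axioms_of_def axiom_set_def)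
  have sub: "a \<in> pts S" if "a \<in> circ K U V" "U \<subseteq> pts S" "V \<subseteq> pts S" for a U V
    using circ_pts that by blast
  have Y: "a \<in> pts S \<and> W \<subseteq> pts S"
    if "(a, W) \<in> comm_assoc_axioms (pts S) (circ K) (axioms_of (pts S) J C)" for a W
    using that X unfolding comm_assoc_axioms_def by (auto simp: circ_pts dest!: sub)
  have Z: "a \<in> pts S \<and> W \<subseteq> pts S"
    if "(a, W) \<in> local_axioms (pts S) (circ K) (comm_assoc_axioms (pts S) (circ K) (axioms_of (pts S) J C))"
    for a W
    using that Y unfolding local_axioms_def by (auto simp: circ_pts dest!: sub)
  show ?thesis by (subst S) (rule ind_generatedI[OF Z])
qed

lemma circ_preserves_cover: "preserves_cover S (S \<otimes> S) m"
proof (rule preserves_cover_tensorI; (rule ind_generated_cc_basic_cover)?; unfold prod.case)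
  fix b V c assume b: "cov S b V" "c \<in> pts S"
  note bV = cov_pts[OF ind_generated_cc_basic_cover b(1)]
  have "covs S (circ K {b} {c}) (circ K V {c})"
    using b bV
    by (intro circ_covs) (auto simp: covs_def intro: basic_cover_refl[OF ind_generated_cc_basic_cover])
  moreover have "circ K V {c} = (\<Union>v\<in>V. circ K {v} {c})"
    using b bV by (auto simp: circ_eq_lift_op lift_op_def)
  ultimately show "covs S (circ K {b} {c}) (\<Union>v\<in>V. circ K {v} {c})" by simp
next
  fix b V c assume b: "b \<in> pts S" "cov S c V"
  note bV = cov_pts[OF ind_generated_cc_basic_cover b(2)]
  have "covs S (circ K {b} {c}) (circ K {b} V)"
    using b bV
    by (intro circ_covs) (auto simp: covs_def intro: basic_cover_refl[OF ind_generated_cc_basic_cover])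
  moreover have "circ K {b} V = (\<Union>v\<in>V. circ K {b} {v})"
    using b bV by (auto simp: circ_eq_lift_op lift_op_def)
  ultimately show "covs S (circ K {b} {c}) (\<Union>v\<in>V. circ K {b} {v})" by simp
qed (simp add: circ_pts)

text \<open>
  Only one inclusion of associativity is postulated. Commutativity gives the other: with \<open>\<lhd>\<close> for
  \<^const>\<open>covs\<close>, \<open>U(VW) \<lhd> (VW)U \<lhd> (WV)U \<lhd> W(VU) \<lhd> W(UV) \<lhd> (UV)W\<close>.
\<close>

lemma circ_assoc_covs_converse:
  assumes U: "U \<subseteq> pts S" "V \<subseteq> pts S" "W \<subseteq> pts S"
  shows "covs S (circ K U (circ K V W)) (circ K (circ K U V) W)"
proof -
  note B = ind_generated_cc_basic_cover
  note t = covs_trans[OF B]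
  have "covs S (circ K U (circ K V W)) (circ K (circ K V W) U)" using U by (simp add: circ_comm_covs circ_pts)
  moreover have "covs S (circ K (circ K V W) U) (circ K (circ K W V) U)"
    using U by (simp add: circ_covs circ_comm_covs covs_subset[OF B] circ_pts)
  moreover have "covs S (circ K (circ K W V) U) (circ K W (circ K V U))" using U by (simp add: circ_assoc_covs)
  moreover have "covs S (circ K W (circ K V U)) (circ K W (circ K U V))"
    using U by (simp add: circ_covs circ_comm_covs covs_subset[OF B] circ_pts)
  moreover have "covs S (circ K W (circ K U V)) (circ K (circ K U V) W)" using U by (simp add: circ_comm_covs circ_pts)
  ultimately show ?thesis
    using t U by (meson circ_pts)
qed

lemma comonoid_laws_circ:
  assumes I: "is_unit K I"
  shows "comonoid_laws S m I"
proof -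
  note B = ind_generated_cc_basic_cover
  have IS: "I \<subseteq> pts S" using I by (simp add: is_unit_def)
  have "eqA S (circ K {a} (circ K {b} {c})) (circ K (circ K {a} {b}) {c})"
    if "a \<in> pts S" "b \<in> pts S" "c \<in> pts S" for a b c
    using that by (simp add: eqA_iff_covs[OF B] circ_pts circ_assoc_covs circ_assoc_covs_converse)
  moreover have "eqA S (circ K {a} {b}) (circ K {b} {a})" if "a \<in> pts S" "b \<in> pts S" for a b
    using that by (simp add: eqA_iff_covs[OF B] circ_pts circ_comm_covs)
  ultimately show ?thesis
    using I IS unfolding comonoid_laws_def is_unit_def by (simp add: circ_eq_lift_op[symmetric] circ_pts)
qed

end

section \<open>The equivalence\<close>

definition comonoid_of :: "'a ccover \<Rightarrow> 'a comon" where
  "comonoid_of K = \<lparr>obj = base K, mult = mor_by (base K) (base K \<otimes> base K) (\<lambda>(a, b). circ K {a} {b}),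
     counit = mor_by (base K) unitE (\<lambda>_. SOME I. is_unit K I)\<rparr>"

text \<open>
  The product of points is the \<^const>\<open>preimage\<close>, since a comonoid carries only an equivalence
  class of relations. The restriction to subsets of the points is the extensionality built into
  \<^const>\<open>convergent_cover\<close>.
\<close>

definition ccover_of :: "'a comon \<Rightarrow> 'a ccover" where
  "ccover_of M = \<lparr>base = obj M,
     circ = (\<lambda>U\<in>Pow (pts (obj M)). \<lambda>V\<in>Pow (pts (obj M)). lift_op (preimage (mult M)) U V)\<rparr>"

lemma obj_comonoid_of [simp]: "obj (comonoid_of K) = base K"
  by (simp add: comonoid_of_def)

lemma some_unit: "unital K \<Longrightarrow> is_unit K (SOME I. is_unit K I)"
  unfolding unital_def by (rule someI_ex)

lemma comm_comonoid_comonoid_of: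
  assumes K: "ind_generated_cc K" and u: "unital K"
  shows "comm_comonoid (comonoid_of K)"
proof -
  note I = some_unit[OF u]
  have e: "preserves_cover (base K) unitE (\<lambda>_. SOME I. is_unit K I)"
    using I by (simp add: preserves_cover_to_unitE ind_generated_cc_basic_cover[OF K] is_unit_def)
  show ?thesis
    unfolding comonoid_of_def
      comm_comonoid_iff_laws[OF ind_generated_base[OF K] circ_preserves_cover[OF K] e]
    by (rule comonoid_laws_circ[OF K I])
qed

lemma comm_comonoid_preimage:
  assumes M: "comm_comonoid M"
  shows "ind_generated (obj M)" "basic_cover (obj M)"
    "preserves_cover (obj M) (obj M \<otimes> obj M) (preimage (mult M))"
    "mor_by (obj M) (obj M \<otimes> obj M) (preimage (mult M)) = mult M"
    "preserves_cover (obj M) unitE (preimage (counit M))"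
    "mor_by (obj M) unitE (preimage (counit M)) = counit M"
    "comonoid_laws (obj M) (preimage (mult M)) (preimage (counit M) ())"
proof -
  show g: "ind_generated (obj M)" using M by (simp add: comm_comonoid_def Let_def)
  then show S: "basic_cover (obj M)" by (rule ind_generated_basic_cover)
  have h: "mult M \<in> bc_hom (obj M) (obj M \<otimes> obj M)" "counit M \<in> bc_hom (obj M) unitE"
    using M by (simp_all add: comm_comonoid_def Let_def)
  note m = bc_hom_preimage[OF S basic_cover_tensor h(1)] and e = bc_hom_preimage[OF S basic_cover_unitE h(2)]
  show "preserves_cover (obj M) (obj M \<otimes> obj M) (preimage (mult M))"
    "mor_by (obj M) (obj M \<otimes> obj M) (preimage (mult M)) = mult M"
    "preserves_cover (obj M) unitE (preimage (counit M))"
    "mor_by (obj M) unitE (preimage (counit M)) = counit M"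
    by (fact m e)+
  have eq: "\<lparr>obj = obj M, mult = mult M, counit = counit M\<rparr> = M" by (cases M) simp
  show "comonoid_laws (obj M) (preimage (mult M)) (preimage (counit M) ())"
    using comm_comonoid_iff_laws[OF g m(1) e(1)] M
    unfolding m(2) e(2) eq by simp
qed

lemma ccover_of_unital:
  assumes M: "comm_comonoid M"
  shows "ind_generated_cc (ccover_of M)" "is_unit (ccover_of M) (preimage (counit M) ())"
proof -
  note L = comm_comonoid_preimage[OF M]
  have I: "preimage (counit M) () \<subseteq> pts (obj M)"
    using L(5) by (simp add: preserves_cover_to_unitE[OF L(2)])
  show "ind_generated_cc (ccover_of M)" "is_unit (ccover_of M) (preimage (counit M) ())"
    by (rule ind_generated_cc_of_laws[OF L(1,3,7) I] is_unit_of_laws[OF L(1,3,7) I];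
        simp add: ccover_of_def)+
qed

text \<open>
  The comultiplications agree on the nose, because saturating the inverse images does not change the
  equivalence class. The counits agree because units are unique up to \<^const>\<open>eqA\<close>.
\<close>

lemma comonoid_of_ccover_of:
  assumes M: "comm_comonoid M"
  shows "comonoid_of (ccover_of M) = M"
proof -
  note L = comm_comonoid_preimage[OF M] and U = ccover_of_unital[OF M]
  let ?S = "obj M" and ?K = "ccover_of M"
  have base: "base ?K = ?S" by (simp add: ccover_of_def)
  have "mor_by ?S (?S \<otimes> ?S) (\<lambda>(a, b). circ ?K {a} {b}) =
      mor_by ?S (?S \<otimes> ?S) (preimage (mult M))"
    by (rule mor_by_cong) (auto simp: ccover_of_def lift_op_singletons eqA_refl)
  moreover have "mor_by ?S unitE (\<lambda>_. SOME I. is_unit ?K I) = counit M"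
  proof -
    have "is_unit ?K (SOME I. is_unit ?K I)" using some_unit U(2) unfolding unital_def by blast
    from is_unit_unique[OF ind_generated_cc_convergent[OF U(1)] this U(2)]
    have "mor_by ?S unitE (\<lambda>_. SOME I. is_unit ?K I) = mor_by ?S unitE (preimage (counit M))"
      by (intro mor_by_cong) (simp add: base)
    then show ?thesis by (simp add: L(6))
  qed
  ultimately show ?thesis unfolding comonoid_of_def base by (simp add: L(4))
qed

text \<open>
  At \<open>(b\<^sub>1, b\<^sub>2)\<close> the two sides of the square for comultiplications are the inverse image of
  \<open>b\<^sub>1 \<circ> b\<^sub>2\<close> and the product of the inverse images of \<open>b\<^sub>1\<close> and \<open>b\<^sub>2\<close>; the triangle for counits compares
  the inverse image of a chosen unit of \<open>L\<close> with a chosen unit of \<open>K\<close>, and by uniqueness of units up to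
  \<^const>\<open>eqA\<close> the choices do not matter.
\<close>

lemma ucc_map_iff:
  assumes K: "ind_generated_cc K" "unital K" and L: "ind_generated_cc L" "unital L"
  shows "ucc_map K L r \<longleftrightarrow> bc_map (base K) (base L) r \<and>
    mor_of (base K) (base L) r \<in> comonoid_hom (comonoid_of K) (comonoid_of L)"
proof (cases "bc_map (base K) (base L) r")
  case r: True
  let ?S = "base K" and ?T = "base L" and ?\<phi> = "\<lambda>b. r\<inverse> `` {b}"
  let ?m = "\<lambda>(a, b). circ K {a} {b}" and ?n = "\<lambda>(a, b). circ L {a} {b}"
  let ?I = "SOME I. is_unit K I" and ?J = "SOME I. is_unit L I"
  note S = ind_generated_cc_basic_cover[OF K(1)] and T = ind_generated_cc_basic_cover[OF L(1)]
  note m = circ_preserves_cover[OF K(1)] and n = circ_preserves_cover[OF L(1)]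
  note I = some_unit[OF K(2)] and J = some_unit[OF L(2)]
  note SS = basic_cover_tensor[of ?S ?S] and TT = basic_cover_tensor[of ?T ?T]
  have JT: "?J \<subseteq> pts ?T" using J by (simp add: is_unit_def)
  have j: "preserves_cover ?T unitE (\<lambda>_. ?J)"
    using JT by (simp add: preserves_cover_to_unitE[OF T])
  have \<phi>: "preserves_cover ?S ?T ?\<phi>" using r by (simp add: bc_map_iff_preserves_cover[OF T])
  note \<phi>\<phi> = preserves_cover_tensor[OF S S T T \<phi> \<phi>]
  have im: "r\<inverse> `` V = \<Union>(?\<phi> ` V)" for V by blast
  have 1: "mor_by ?T (?T \<otimes> ?T) ?n \<cdot> mor_by ?S ?T ?\<phi> =
      (mor_by ?S ?T ?\<phi> \<otimes>\<^sub>m mor_by ?S ?T ?\<phi>) \<cdot> mor_by ?S (?S \<otimes> ?S) ?m \<longleftrightarrow>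
      (\<forall>b\<^sub>1\<in>pts ?T. \<forall>b\<^sub>2\<in>pts ?T. eqA ?S (r\<inverse> `` circ L {b\<^sub>1} {b\<^sub>2}) (circ K (?\<phi> b\<^sub>1) (?\<phi> b\<^sub>2)))"
  proof -
    have c: "circ K (?\<phi> b\<^sub>1) (?\<phi> b\<^sub>2) = \<Union>(?m ` (?\<phi> b\<^sub>1 \<times> ?\<phi> b\<^sub>2))" if "b\<^sub>1 \<in> pts ?T" "b\<^sub>2 \<in> pts ?T" for b\<^sub>1 b\<^sub>2
      using circ_eq_lift_op[OF K(1) preserves_cover_pts[OF \<phi> that(1)] preserves_cover_pts[OF \<phi> that(2)]]
      by (simp add: lift_op_def)
    show ?thesis
      unfolding mor_by_comp[OF S T TT \<phi> n] mor_by_tensor[OF S S T T \<phi> \<phi>]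
        mor_by_comp[OF S SS TT m \<phi>\<phi>] mor_by_eq_iff[OF TT preserves_cover_comp[OF T TT \<phi> n]]
      by (simp add: im[symmetric] c)
  qed
  have 2: "mor_by ?T unitE (\<lambda>_. ?J) \<cdot> mor_by ?S ?T ?\<phi> = mor_by ?S unitE (\<lambda>_. ?I) \<longleftrightarrow>
      (\<forall>I J. is_unit K I \<and> is_unit L J \<longrightarrow> eqA ?S (r\<inverse> `` J) I)"
  proof -
    have "eqA ?S (r\<inverse> `` J') I'" if "eqA ?S (r\<inverse> `` ?J) ?I" "is_unit K I'" "is_unit L J'" for I' J'
    proof -
      have "eqA ?S (r\<inverse> `` J') (r\<inverse> `` ?J)"
        unfolding im[of J'] im[of ?J]
        by (intro preserves_cover_eqA[OF S T \<phi>] JT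
            is_unit_unique[OF ind_generated_cc_convergent[OF L(1)] that(3) J])
          (use that(3) in \<open>simp add: is_unit_def\<close>)
      moreover have "eqA ?S ?I I'"
        by (rule is_unit_unique[OF ind_generated_cc_convergent[OF K(1)] I that(2)])
      ultimately show ?thesis using that(1) eqA_trans by metis
    qed
    then have "eqA ?S (r\<inverse> `` ?J) ?I \<longleftrightarrow> (\<forall>I J. is_unit K I \<and> is_unit L J \<longrightarrow> eqA ?S (r\<inverse> `` J) I)"
      using I J by blast
    then show ?thesis
      unfolding mor_by_comp[OF S T basic_cover_unitE \<phi> j]
        mor_by_eq_iff[OF basic_cover_unitE preserves_cover_comp[OF T basic_cover_unitE \<phi> j]]
      by (simp add: im[symmetric])
  qed
  show ?thesis
    using r mor_by_in_bc_hom[OF T \<phi>]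
    unfolding ucc_map_def comonoid_hom_def comonoid_of_def mor_of_eq_mor_by comon.simps mem_Collect_eq 1 2
    by blast
qed (simp add: ucc_map_def)

lemma ucc_hom_eq_comonoid_hom:
  assumes "ind_generated_cc K" "unital K" "ind_generated_cc L" "unital L"
  shows "ucc_hom K L = comonoid_hom (comonoid_of K) (comonoid_of L)"
proof -
  have "comonoid_hom (comonoid_of K) (comonoid_of L) \<subseteq> bc_hom (base K) (base L)"
    by (auto simp: comonoid_hom_def comonoid_of_def)
  then show ?thesis
    unfolding ucc_hom_def ucc_map_iff[OF assms] bc_hom_def by blast
qed

lemma category_coCMon: "category (coCMon_BCov_i :: ('a comon, ('a, 'a) mor) cat)"
proof -
  have B: "basic_cover (obj M)" if "comm_comonoid M" for M :: "'a comon"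
    using comm_comonoid_preimage(2)[OF that] .
  have mu: "mult M \<in> bc_hom (obj M) (obj M \<otimes> obj M)" and eta: "counit M \<in> bc_hom (obj M) unitE"
    if "comm_comonoid M" for M :: "'a comon"
    using that by (simp_all add: comm_comonoid_def Let_def)
  have h: "f \<in> bc_hom (obj M) (obj N)" if "f \<in> comonoid_hom M N" for f and M N :: "'a comon"
    using that by (simp add: comonoid_hom_def)
  have id: "bc_id (obj M) \<in> comonoid_hom M M" if "comm_comonoid M" for M :: "'a comon"
    using that B[OF that]
    by (simp add: comonoid_hom_def bc_id_in_hom tensor_mor_id bc_comp_id[OF _ basic_cover_tensor mu]
        bc_comp_id[OF _ basic_cover_unitE eta])
  have comp: "g \<cdot> f \<in> comonoid_hom M P"
    if o: "comm_comonoid M" "comm_comonoid N" "comm_comonoid P"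
      and f: "f \<in> comonoid_hom M N" and g: "g \<in> comonoid_hom N P"
    for M N P :: "'a comon" and f g
  proof -
    note b = B[OF o(1)] B[OF o(2)] B[OF o(3)]
    note bb = basic_cover_tensor[of "obj M" "obj M"] basic_cover_tensor[of "obj N" "obj N"]
      basic_cover_tensor[of "obj P" "obj P"]
    note ff = tensor_mor_in_hom[OF b(1,1,2,2) h[OF f] h[OF f]]
    note gg = tensor_mor_in_hom[OF b(2,2,3,3) h[OF g] h[OF g]]
    have "mult P \<cdot> (g \<cdot> f) = (mult P \<cdot> g) \<cdot> f"
      by (rule bc_comp_assoc[OF b bb(3) h[OF f] h[OF g] mu[OF o(3)]])
    also have "mult P \<cdot> g = (g \<otimes>\<^sub>m g) \<cdot> mult N" using g by (simp add: comonoid_hom_def)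
    also have "((g \<otimes>\<^sub>m g) \<cdot> mult N) \<cdot> f = (g \<otimes>\<^sub>m g) \<cdot> (mult N \<cdot> f)"
      by (rule bc_comp_assoc[OF b(1,2) bb(2,3) h[OF f] mu[OF o(2)] gg, symmetric])
    also have "mult N \<cdot> f = (f \<otimes>\<^sub>m f) \<cdot> mult M" using f by (simp add: comonoid_hom_def)
    also have "(g \<otimes>\<^sub>m g) \<cdot> ((f \<otimes>\<^sub>m f) \<cdot> mult M) = ((g \<otimes>\<^sub>m g) \<cdot> (f \<otimes>\<^sub>m f)) \<cdot> mult M"
      by (rule bc_comp_assoc[OF b(1) bb mu[OF o(1)] ff gg])
    also have "(g \<otimes>\<^sub>m g) \<cdot> (f \<otimes>\<^sub>m f) = (g \<cdot> f) \<otimes>\<^sub>m (g \<cdot> f)"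
      by (rule tensor_mor_comp[OF b h[OF f] h[OF g], symmetric])
    finally have 1: "mult P \<cdot> (g \<cdot> f) = ((g \<cdot> f) \<otimes>\<^sub>m (g \<cdot> f)) \<cdot> mult M" .
    have "counit P \<cdot> (g \<cdot> f) = (counit P \<cdot> g) \<cdot> f"
      by (rule bc_comp_assoc[OF b basic_cover_unitE h[OF f] h[OF g] eta[OF o(3)]])
    also have "\<dots> = counit M" using f g by (simp add: comonoid_hom_def)
    finally show ?thesis
      using 1 bc_comp_in_hom[OF b h[OF f] h[OF g]] by (simp add: comonoid_hom_def)
  qed
  show ?thesis
    unfolding category_def coCMon_BCov_i_def cat.simps mem_Collect_eq
  proof (intro conjI ballI; unfold mem_Collect_eq)
    fix M N P Q :: "'a comon" and f g k
    assume o: "comm_comonoid M" "comm_comonoid N" "comm_comonoid P" "comm_comonoid Q"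
      and "f \<in> comonoid_hom M N" "g \<in> comonoid_hom N P" "k \<in> comonoid_hom P Q"
    then show "k \<cdot> (g \<cdot> f) = (k \<cdot> g) \<cdot> f"
      by (intro bc_comp_assoc[OF B[OF o(1)] B[OF o(2)] B[OF o(3)] B[OF o(4)]] h)
  qed (simp_all add: id comp bc_comp_id[OF B B h])
qed

text \<open>
  If \<open>\<C>\<close> has the morphisms of \<open>\<D>\<close> between images under \<open>F\<close>, then it inherits the category laws, and a
  section \<open>G\<close> of \<open>F\<close> on objects is an inverse up to isomorphism: \<open>A\<close> and \<open>G (F A)\<close> have the same
  image under \<open>F\<close>, so the identity of \<open>F A\<close> serves as an isomorphism between them.
\<close>

lemma equivalent_via_equal_homs:
  fixes \<C> :: "('o, 'm) cat" and \<D> :: "('p, 'm) cat"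
  assumes \<D>: "category \<D>"
    and F: "\<And>A. A \<in> Obj \<C> \<Longrightarrow> F A \<in> Obj \<D>" and G: "\<And>M. M \<in> Obj \<D> \<Longrightarrow> G M \<in> Obj \<C>"
    and FG: "\<And>M. M \<in> Obj \<D> \<Longrightarrow> F (G M) = M"
    and Hom: "\<And>A B. A \<in> Obj \<C> \<Longrightarrow> B \<in> Obj \<C> \<Longrightarrow> Hom \<C> A B = Hom \<D> (F A) (F B)"
    and Idt: "\<And>A. A \<in> Obj \<C> \<Longrightarrow> Idt \<C> A = Idt \<D> (F A)"
    and Cmp: "Cmp \<C> = Cmp \<D>"
  shows "equivalent_categories \<C> \<D>"
proof -
  have id: "Idt \<D> M \<in> Hom \<D> M M" if "M \<in> Obj \<D>" for M
    using \<D> that by (simp add: category_def)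
  have unit: "Cmp \<D> f (Idt \<D> M) = f" "Cmp \<D> (Idt \<D> N) f = f"
    if "M \<in> Obj \<D>" "N \<in> Obj \<D>" "f \<in> Hom \<D> M N" for M N f
    using \<D> that by (simp_all add: category_def)
  have \<C>: "category \<C>"
    unfolding category_def
  proof (intro conjI ballI)
    fix A B C D f g h assume o: "A \<in> Obj \<C>" "B \<in> Obj \<C>" "C \<in> Obj \<C>" "D \<in> Obj \<C>"
      and fgh: "f \<in> Hom \<C> A B" "g \<in> Hom \<C> B C" "h \<in> Hom \<C> C D"
    have "f \<in> Hom \<D> (F A) (F B)" "g \<in> Hom \<D> (F B) (F C)" "h \<in> Hom \<D> (F C) (F D)"
      using fgh o by (simp_all add: Hom)
    then show "Cmp \<C> h (Cmp \<C> g f) = Cmp \<C> (Cmp \<C> h g) f"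
      using \<D> F[OF o(1)] F[OF o(2)] F[OF o(3)] F[OF o(4)] unfolding category_def Cmp by blast
  next
    fix A B C f g assume o: "A \<in> Obj \<C>" "B \<in> Obj \<C>" "C \<in> Obj \<C>"
      and fg: "f \<in> Hom \<C> A B" "g \<in> Hom \<C> B C"
    have "f \<in> Hom \<D> (F A) (F B)" "g \<in> Hom \<D> (F B) (F C)"
      using fg o by (simp_all add: Hom)
    then have "Cmp \<D> g f \<in> Hom \<D> (F A) (F C)"
      using \<D> F[OF o(1)] F[OF o(2)] F[OF o(3)] unfolding category_def by blast
    then show "Cmp \<C> g f \<in> Hom \<C> A C" by (simp add: Hom Cmp o)
  next
    fix A B f assume "A \<in> Obj \<C>" "B \<in> Obj \<C>" "f \<in> Hom \<C> A B"
    then show "Cmp \<C> f (Idt \<C> A) = f" "Cmp \<C> (Idt \<C> B) f = f"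
      by (simp_all add: Hom Cmp Idt unit[OF F F])
  qed (simp add: Hom Idt id F)
  let ?F = "\<lparr>omap = F, amap = \<lambda>A B f. f\<rparr>" and ?G = "\<lparr>omap = G, amap = \<lambda>A B f. f\<rparr>"
  have "is_functor \<C> \<D> ?F" by (simp add: is_functor_def F Hom Idt Cmp)
  moreover have "is_functor \<D> \<C> ?G" by (simp add: is_functor_def G Hom Idt Cmp FG)
  moreover have "naturally_isomorphic \<C> \<C> (comp_funct ?G ?F) id_funct"
    unfolding naturally_isomorphic_def
  proof (intro exI[of _ "\<lambda>A. Idt \<D> (F A)"] conjI ballI)
    fix A assume A: "A \<in> Obj \<C>"
    have i: "Idt \<D> (F A) \<in> Hom \<C> (G (F A)) A" "Idt \<D> (F A) \<in> Hom \<C> A (G (F A))"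
      using A by (simp_all add: Hom F G FG id)
    have "Cmp \<D> (Idt \<D> (F A)) (Idt \<D> (F A)) = Idt \<D> (F A)" using A by (simp add: unit(1)[OF F F] id F)
    then show "is_iso \<C> (omap (comp_funct ?G ?F) A) (omap id_funct A) (Idt \<D> (F A))"
      using A i by (auto simp: is_iso_def comp_funct_def id_funct_def Cmp Idt F G FG)
  next
    fix A B f assume "A \<in> Obj \<C>" "B \<in> Obj \<C>" "f \<in> Hom \<C> A B"
    then show "Cmp \<C> (Idt \<D> (F B)) (amap (comp_funct ?G ?F) A B f) =
        Cmp \<C> (amap id_funct A B f) (Idt \<D> (F A))"
      by (simp add: comp_funct_def id_funct_def Cmp Hom unit[OF F F])
  qed
  moreover have "naturally_isomorphic \<D> \<D> (comp_funct ?F ?G) id_funct"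
    unfolding naturally_isomorphic_def
  proof (intro exI[of _ "Idt \<D>"] conjI ballI)
    fix M assume M: "M \<in> Obj \<D>"
    have "Cmp \<D> (Idt \<D> M) (Idt \<D> M) = Idt \<D> M" using M by (simp add: unit(1)[OF M M] id)
    then show "is_iso \<D> (omap (comp_funct ?F ?G) M) (omap id_funct M) (Idt \<D> M)"
      using M id[OF M] by (auto simp: is_iso_def comp_funct_def id_funct_def FG)
  next
    fix M N f assume "M \<in> Obj \<D>" "N \<in> Obj \<D>" "f \<in> Hom \<D> M N"
    then show "Cmp \<D> (Idt \<D> N) (amap (comp_funct ?F ?G) M N f) =
        Cmp \<D> (amap id_funct M N f) (Idt \<D> M)"
      by (simp add: comp_funct_def id_funct_def unit)
  qed
  ultimately show ?thesis unfolding equivalent_categories_def using \<C> \<D> by blast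
qed

theorem corollary4p19:
  "equivalent_categories (uCBCov_i :: ('a ccover, ('a, 'a) mor) cat)
     (coCMon_BCov_i :: ('a comon, ('a, 'a) mor) cat)"
proof (rule equivalent_via_equal_homs[where F = comonoid_of and G = ccover_of, OF category_coCMon])
qed (auto simp: uCBCov_i_def coCMon_BCov_i_def comm_comonoid_comonoid_of ccover_of_unital(1)
    unital_def ucc_hom_eq_comonoid_hom comonoid_of_ccover_of
    intro: ccover_of_unital(2))

end
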